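(* Let $0<\alpha\le 1$, let $\{\mathcal{N}^{\alpha}_{c}(t)\}_{t\ge 0}$ be the convoluted fractional Poisson process and $\{\mathcal{N}_{c}(t)\}_{t\ge 0}$ the convoluted Poisson process, both with the same intensity parameters $\{\lambda_j\}_{j\in\mathbb{Z}}$. Let $\{T_{2\alpha}(t)\}_{t>0}$ be a random process, independent of $\{\mathcal{N}_{c}(t)\}$, whose distribution at each time is given by the folded solution of the fractional diffusion equation $$\partial^{2\alpha}_{t}u(x,t)=\frac{\partial^{2}}{\partial x^{2}}u(x,t),\qquad x\in\mathbb{R},\ t>0,$$ with $u(x,0)=\delta(x)$ for $0<\alpha\le 1$ and additionally $\frac{\partial}{\partial t}u(x,0)=0$ for $1/2<\alpha\le 1$. Then, for every $t>0$, $$\mathcal{N}^{\alpha}_{c}(t)\overset{d}{=}\mathcal{N}_{c}(T_{2\alpha}(t)),$$ where $\overset{d}{=}$ denotes equality in distribution.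
   Context: $\mathbb{N}_0$ denotes the non-negative integers. Intensity parameters: $\{\lambda_j\}_{j\in\mathbb{Z}}$ are real numbers with $\lambda_j=0$ for $j<0$, $\lambda_0>0$, $\lambda_j\ge 0$ for $j>0$, non-increasing for $j\ge 0$, and $\lim_{j\to\infty}\lambda_{j+1}/\lambda_j<1$ (this limit condition is regarded as satisfied if $\lambda_j=0$ for all large $j$). Fractional derivative (Dzhrbashyan–Caputo): $\partial_t^{\beta}f(t)=\frac{1}{\Gamma(1-\beta)}\int_0^t (t-s)^{-\beta}f'(s)\,\mathrm{d}s$ for $0<\beta<1$, $\partial_t^{1}f=f'$, $\partial_t^{\beta}f(t)=\frac{1}{\Gamma(2-\beta)}\int_0^t (t-s)^{1-\beta}f''(s)\,\mathrm{d}s$ for $1<\beta<2$, $\partial_t^2 f=f''$. Convoluted fractional Poisson process (CFPP): an $\mathbb{N}_0$-valued stochastic process $\{\mathcal{N}^{\alpha}_{c}(t)\}_{t\ge0}$ whose state probabilities $p^{\alpha}_{c}(n,t)=\Pr\{\mathcal{N}^{\alpha}_{c}(t)=n\}$ satisfy, for all $n\ge 0$, $$\partial_t^{\alpha}p^{\alpha}_{c}(n,t)=-\lambda_n * p^{\alpha}_{c}(n,t)+\lambda_{n-1}*p^{\alpha}_{c}(n-1,t),$$ where $\lambda_n*p^{\alpha}_{c}(n,t)=\sum_{j=-\infty}^{\infty}\lambda_j p^{\alpha}_{c}(n-j,t)$ is the discrete convolution in the space variable, with $p^{\alpha}_{c}(0,0)=1$, $p^{\alpha}_{c}(n,0)=0$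 for $n\ge 1$, and $p^{\alpha}_{c}(-n,t)=0$ for $n\ge 1$, $t\ge 0$. Equivalently, $\partial_t^{\alpha}p^{\alpha}_{c}(n,t)=-\lambda_0 p^{\alpha}_{c}(n,t)+\sum_{j=1}^{n}(\lambda_{j-1}-\lambda_j)p^{\alpha}_{c}(n-j,t)$. The convoluted Poisson process (CPP) $\{\mathcal{N}_c(t)\}$ is the case $\alpha=1$; it is a Lévy process. Folded solution: the law of $T_{2\alpha}(t)$ is carried by $(0,\infty)$ with density $f_{T_{2\alpha}}(x,t)=2u(x,t)$, $x>0$ (for $\alpha=1$ it is the point mass at $t$). It is known that its Laplace transform in time is $\int_{0}^{\infty}e^{-st}f_{T_{2\alpha}}(x,t)\,\mathrm{d}t=s^{\alpha-1}e^{-xs^{\alpha}}$ for $x>0$, $s>0$. *)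

theory Defs
  imports "HOL-Probability.Probability"
begin

section \<open>Intensity parameters\<close>

definition intensity_parameters :: "(int \<Rightarrow> real) \<Rightarrow> bool" where
  "intensity_parameters l \<longleftrightarrow>
     (\<forall>j<0. l j = 0) \<and> l 0 > 0 \<and> (\<forall>j>0. l j \<ge> 0) \<and>
     (\<forall>i j. 0 \<le> i \<longrightarrow> i \<le> j \<longrightarrow> l j \<le> l i) \<and>
     ((\<exists>J. \<forall>j\<ge>J. l j = 0) \<or>
      (\<exists>L<1. (\<lambda>j::nat. l (int j + 1) / l (int j)) \<longlonglongrightarrow> L))"

definition discrete_conv :: "(int \<Rightarrow> real) \<Rightarrow> (int \<Rightarrow> real) \<Rightarrow> int \<Rightarrow> real" where
  "discrete_conv l q n = (\<Sum>\<^sub>\<infinity>j\<in>UNIV. l j * q (n - j))"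

section \<open>Dzhrbashyan--Caputo derivative\<close>

text \<open>Orders \<open>b\<close> in \<open>(0, 2]\<close> and times \<open>t > 0\<close> are meant. Only values of \<open>f\<close> at positive
  times are used, so \<open>f\<close> need not be differentiable at 0.\<close>

definition caputo_derivative :: "real \<Rightarrow> (real \<Rightarrow> real) \<Rightarrow> real \<Rightarrow> real" where
  "caputo_derivative b f t =
     (if b < 1 then
        1 / Gamma (1 - b) * (LBINT s:{0<..<t}. (t - s) powr (- b) * deriv f s)
      else if b = 1 then deriv f t
      else if b < 2 then
        1 / Gamma (2 - b) * (LBINT s:{0<..<t}. (t - s) powr (1 - b) * deriv (deriv f) s)
      else deriv (deriv f) t)"

text \<open>As \<open>deriv\<close> and the Lebesgue integral are total functions, existence of the derivative
  is stated separately.\<close>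

definition has_caputo_derivative :: "real \<Rightarrow> (real \<Rightarrow> real) \<Rightarrow> bool" where
  "has_caputo_derivative b f \<longleftrightarrow>
     (\<forall>t>0. f differentiable at t) \<and>
     (1 < b \<longrightarrow> (\<forall>t>0. deriv f differentiable at t)) \<and>
     (b < 1 \<longrightarrow>
        (\<forall>t>0. set_integrable lborel {0<..<t} (\<lambda>s. (t - s) powr (- b) * deriv f s))) \<and>
     (1 < b \<and> b < 2 \<longrightarrow>
        (\<forall>t>0. set_integrable lborel {0<..<t} (\<lambda>s. (t - s) powr (1 - b) * deriv (deriv f) s)))"

section \<open>Convoluted (fractional) Poisson processes\<close>

text \<open>The space variable is an integer, so that the state probabilities vanish at negative
  states.\<close>

definition state_prob :: "'a measure \<Rightarrow> (real \<Rightarrow> 'a \<Rightarrow> nat) \<Rightarrow> int \<Rightarrow> real \<Rightarrow> real" where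
  "state_prob M N n t = measure M {\<omega> \<in> space M. int (N t \<omega>) = n}"

text \<open>The differential equation is required for \<open>t > 0\<close> (for order below 1 its left-hand side
  is 0 at \<open>t = 0\<close> while the right-hand side is not); the initial values are attained
  continuously.\<close>

definition cfpp :: "real \<Rightarrow> (int \<Rightarrow> real) \<Rightarrow> 'a measure \<Rightarrow> (real \<Rightarrow> 'a \<Rightarrow> nat) \<Rightarrow> bool" where
  "cfpp a l M N \<longleftrightarrow>
     prob_space M \<and>
     (\<forall>t\<ge>0. N t \<in> measurable M (count_space UNIV)) \<and>
     state_prob M N 0 0 = 1 \<and> (\<forall>n\<ge>1. state_prob M N n 0 = 0) \<and>
     (\<forall>n\<ge>0.
        (state_prob M N n \<longlongrightarrow> state_prob M N n 0) (at_right 0) \<and>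
        has_caputo_derivative a (state_prob M N n) \<and>
        (\<forall>t>0. caputo_derivative a (state_prob M N n) t =
           - discrete_conv l (\<lambda>k. state_prob M N k t) n
           + discrete_conv l (\<lambda>k. state_prob M N k t) (n - 1)))"

text \<open>Stochastic continuity is a consequence of the path regularity and the stationarity of
  the increments.\<close>

definition levy_process :: "'a measure \<Rightarrow> (real \<Rightarrow> 'a \<Rightarrow> real) \<Rightarrow> bool" where
  "levy_process M X \<longleftrightarrow>
     prob_space M \<and>
     (\<forall>t\<ge>0. X t \<in> borel_measurable M) \<and>
     (AE \<omega> in M. X 0 \<omega> = 0) \<and>
     (\<forall>(n::nat) (t::nat \<Rightarrow> real). 0 \<le> t 0 \<and> (\<forall>i<n. t i \<le> t (Suc i)) \<longrightarrow>
        prob_space.indep_vars M (\<lambda>_. borel) (\<lambda>i \<omega>. X (t (Suc i)) \<omega> - X (t i) \<omega>) {..<n}) \<and>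
     (\<forall>s\<ge>0. \<forall>t\<ge>0. distr M borel (\<lambda>\<omega>. X (s + t) \<omega> - X s \<omega>) =
        distr M borel (\<lambda>\<omega>. X t \<omega> - X 0 \<omega>)) \<and>
     (\<forall>\<omega>\<in>space M.
        (\<forall>t\<ge>0. ((\<lambda>s. X s \<omega>) \<longlongrightarrow> X t \<omega>) (at_right t)) \<and>
        (\<forall>t>0. \<exists>y. ((\<lambda>s. X s \<omega>) \<longlongrightarrow> y) (at_left t)))"

definition cpp :: "(int \<Rightarrow> real) \<Rightarrow> 'a measure \<Rightarrow> (real \<Rightarrow> 'a \<Rightarrow> nat) \<Rightarrow> bool" where
  "cpp l M N \<longleftrightarrow> cfpp 1 l M N \<and> levy_process M (\<lambda>t \<omega>. real (N t \<omega>))"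

section \<open>Fractional diffusion equation and its folded solution\<close>

definition test_function :: "(real \<Rightarrow> real) \<Rightarrow> bool" where
  "test_function \<phi> \<longleftrightarrow>
     (\<forall>x. \<phi> differentiable at x) \<and> (\<forall>x. deriv \<phi> differentiable at x) \<and>
     continuous_on UNIV (deriv (deriv \<phi>)) \<and>
     (\<exists>R. \<forall>x. R < \<bar>x\<bar> \<longrightarrow> \<phi> x = 0)"

text \<open>Solution \<open>u x t\<close> of the Cauchy problem for the equation of time order \<open>b\<close> in \<open>(0, 2)\<close>.
  Since the initial datum is a Dirac mass, the equation is understood in the sense of
  distributions in the space variable. A pointwise reading fails: for \<open>b \<noteq> 1\<close> the fundamental
  solution has a corner at \<open>x = 0\<close>. Integrability, locally bounded in time, is the class in
  which the solution is unique.\<close>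

definition frac_diffusion_solution :: "real \<Rightarrow> (real \<Rightarrow> real \<Rightarrow> real) \<Rightarrow> bool" where
  "frac_diffusion_solution b u \<longleftrightarrow>
     (\<lambda>(x, t). u x t) \<in> borel_measurable (borel \<Otimes>\<^sub>M restrict_space borel {0<..}) \<and>
     (\<forall>t>0. integrable lborel (\<lambda>x. u x t)) \<and>
     (\<forall>\<tau>>0. \<exists>C. \<forall>t. 0 < t \<and> t \<le> \<tau> \<longrightarrow> (\<integral>x. \<bar>u x t\<bar> \<partial>lborel) \<le> C) \<and>
     (\<forall>\<phi>. test_function \<phi> \<longrightarrow>
        (let m = (\<lambda>t. \<integral>x. u x t * \<phi> x \<partial>lborel) in
           has_caputo_derivative b m \<and>
           (\<forall>t>0. caputo_derivative b m t = (\<integral>x. u x t * deriv (deriv \<phi>) x \<partial>lborel)) \<and>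
           (m \<longlongrightarrow> \<phi> 0) (at_right 0) \<and>
           (1 < b \<longrightarrow> (deriv m \<longlongrightarrow> 0) (at_right 0))))"

text \<open>For \<open>a = 1\<close> the equation is the wave equation, whose solution consists of the masses 1/2
  at \<open>t\<close> and \<open>-t\<close> and is not a function; its folded version is the unit mass at \<open>t\<close>. All values
  of the process are nonnegative, and not just almost all, because it serves as a time
  parameter.\<close>

definition folded_diffusion_process :: "real \<Rightarrow> 'a measure \<Rightarrow> (real \<Rightarrow> 'a \<Rightarrow> real) \<Rightarrow> bool" where
  "folded_diffusion_process a M T \<longleftrightarrow>
     (\<forall>t>0. T t \<in> borel_measurable M \<and> (\<forall>\<omega>\<in>space M. 0 \<le> T t \<omega>)) \<and>
     (if a = 1 then \<forall>t>0. distr M borel (T t) = return borel t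
      else \<exists>u. frac_diffusion_solution (2 * a) u \<and>
        (\<forall>t>0. (AE x in lborel. 0 < x \<longrightarrow> 0 \<le> u x t) \<and>
           distr M borel (T t) =
             density lborel (\<lambda>x. ennreal (indicator {0<..} x * (2 * u x t)))))"

definition eq_in_distribution ::
  "'a measure \<Rightarrow> ('a \<Rightarrow> 'c) \<Rightarrow> 'b measure \<Rightarrow> ('b \<Rightarrow> 'c) \<Rightarrow> 'c measure \<Rightarrow> bool" where
  "eq_in_distribution M X M' Y S \<longleftrightarrow>
     X \<in> measurable M S \<and> Y \<in> measurable M' S \<and> distr M S X = distr M' S Y"

end

theory Submission
  imports Defs
begin

text \<open>
  Let \<open>p n\<close> be the state probabilities of the convoluted Poisson process. By independence those of
  the subordinated process are \<open>q n t = E (p n (T t))\<close>, and it suffices to compare the Laplace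
  transforms in time of \<open>q n\<close> and of the state probabilities of the fractional process, as both
  are bounded and continuous.

  The Caputo equation of the fractional process is equivalent to a Volterra equation, which turns
  into a triangular recursion in \<open>n\<close> for the Laplace transforms at \<open>s\<close>. To obtain the same recursion
  for \<open>q n\<close>, test the diffusion equation only with functions supported in \<open>(0, \<infinity>)\<close>. There the
  solution is half the density of \<open>T t\<close>, hence nonnegative with known mass, and neither uniqueness
  nor symmetry of the solution is needed: the measure \<open>\<nu>\<close> with density
  \<open>\<integral> exp (- s t) 2 u(x, t) dt\<close> satisfies \<open>\<nu>'' = s^(2\<alpha>) \<nu>\<close> on the half line in the sense of
  distributions. As \<open>\<nu>\<close> is finite, it is a multiple of the exponential distribution of rate
  \<open>s^\<alpha>\<close>, in the form \<open>\<integral> f' d\<nu> = s^\<alpha> \<integral> (f - f(0)) d\<nu>\<close>. For \<open>f = p n\<close> the left-hand side is given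
  by the differential equations of the convoluted Poisson process.
\<close>

section \<open>Laplace transforms and the Caputo derivative\<close>

text \<open>The Laplace transform of the folded density is not a hypothesis: a solution is known
  through its pairings with test functions, and nothing is prescribed about its sign on the negative
  half line. A test function that vanishes near 0 does not see the Dirac mass, so all initial values
  are 0 and the transformed equation has no source term. What is lost at 0 is recovered from the
  total mass of \<open>\<nu>\<close>, which is 1/s because each \<open>T t\<close> has a probability
  law. The equation for \<open>\<nu>\<close> is solved on the side of test functions, by factoring
  D^2 - \<kappa>^2 = (D - \<kappa>)(D + \<kappa>) with \<kappa> = s^\<alpha>. Inverting D + \<kappa>
  from 0 gives a bounded function, and the finiteness of \<open>\<nu>\<close> permits its use; this
  is what excludes the growing exponential. Laplace transforms determine functions up to null sets
  only, so the continuity of \<open>q n\<close> in t is shown separately. It is weak continuity of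
  the laws of \<open>T t\<close>, which the definition supplies only for test functions supported
  away from 0 and infinity. For \<alpha> = 1 there is no density; there T t = t almost surely, and
  the two recursions coincide.\<close>

lemma convolution_integral:
  fixes K G :: "real \<Rightarrow> real"
  assumes K: "integrable lborel K" and G: "integrable lborel G"
  shows "integrable lborel (\<lambda>t. LBINT r. K (t - r) * G r)"
    and "(LBINT t. LBINT r. K (t - r) * G r) = (LBINT t. K t) * (LBINT r. G r)"
proof -
  have Kt: "integrable lborel (\<lambda>t. K (t - r))" for r
    using lborel_integrable_real_affine[OF K, of 1 "- r"] by simp
  have It: "(LBINT t. H (t - r)) = (LBINT t. H t)" for r and H :: "real \<Rightarrow> real"
    using lborel_integral_real_affine[of 1 H "- r"] by simp
  have [measurable]: "K \<in> borel_measurable borel" "G \<in> borel_measurable borel"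
    using K G by (auto dest!: borel_measurable_integrable)
  have int: "integrable (lborel \<Otimes>\<^sub>M lborel) (\<lambda>(r, t). K (t - r) * G r)"
  proof (rule lborel_pair.Fubini_integrable)
    show "integrable lborel (\<lambda>r. LBINT t. norm (case (r, t) of (r, t) \<Rightarrow> K (t - r) * G r))"
      using G by (simp add: abs_mult It[of "\<lambda>t. \<bar>K t\<bar>"])
    show "AE r in lborel. integrable lborel (\<lambda>t. case (r, t) of (r, t) \<Rightarrow> K (t - r) * G r)"
      using Kt by simp
  qed measurable
  show "integrable lborel (\<lambda>t. LBINT r. K (t - r) * G r)"
    using lborel_pair.integrable_snd[OF int] .
  show "(LBINT t. LBINT r. K (t - r) * G r) = (LBINT t. K t) * (LBINT r. G r)"
    using lborel_pair.Fubini_integral[OF int] by (simp add: It)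
qed

section \<open>Laplace transform in time and fractional integrals\<close>

definition laplace_integrable :: "(real \<Rightarrow> real) \<Rightarrow> real \<Rightarrow> bool" where
  "laplace_integrable f s \<longleftrightarrow> set_integrable lborel {0<..} (\<lambda>t. exp (- s * t) * f t)"

definition laplace :: "(real \<Rightarrow> real) \<Rightarrow> real \<Rightarrow> real" where
  "laplace f s = (LBINT t:{0<..}. exp (- s * t) * f t)"

text \<open>The Riemann-Liouville integral of order \<open>b\<close>. The Caputo derivative of an
  order \<open>b\<close> below 1 is the integral of order 1 - b of the derivative.\<close>

definition frac_integral :: "real \<Rightarrow> (real \<Rightarrow> real) \<Rightarrow> real \<Rightarrow> real" where
  "frac_integral b g t = 1 / Gamma b * (LBINT r:{0<..<t}. (t - r) powr (b - 1) * g r)"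

text \<open>For nonnegative integrands the gauge integral and the Lebesgue integral agree. The Gamma
  and Beta integrals come as gauge integrals and are transferred this way.\<close>

lemma has_bochner_integral_nonneg_HK:
  fixes f :: "real \<Rightarrow> real"
  assumes [measurable]: "f \<in> borel_measurable borel" "S \<in> sets borel"
    and "\<And>x. x \<in> S \<Longrightarrow> 0 \<le> f x" and "(f has_integral I) S"
  shows "has_bochner_integral lborel (\<lambda>x. indicator S x * f x) I"
proof -
  have I: "0 \<le> I"
    using assms(3,4) by (rule has_integral_nonneg[rotated])
  have nn: "0 \<le> indicator S x * f x" for x
    using assms(3) by (auto simp: indicator_def)
  have "((\<lambda>x. if x \<in> S then f x else 0) has_integral I) UNIV"
    using assms(4) by (simp add: has_integral_restrict_UNIV)
  also have "(\<lambda>x. if x \<in> S then f x else 0) = (\<lambda>x. indicator S x * f x)"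
    by (auto simp: indicator_def)
  finally have "((\<lambda>x. indicator S x * f x) has_integral I) UNIV" .
  then have "(\<integral>\<^sup>+x. ennreal (indicator S x * f x) \<partial>lborel) = ennreal I"
    using nn by (intro nn_integral_has_integral_lborel) auto
  with nn I show ?thesis
    by (intro has_bochner_integral_nn_integral) auto
qed

text \<open>The Laplace transform of the kernel of the fractional integral: Euler's integral after
  substituting s t for t.\<close>

lemma has_bochner_integral_powr_exp:
  fixes b s :: real
  assumes b: "0 < b" and s: "0 < s"
  shows "has_bochner_integral lborel (\<lambda>t. indicator {0<..} t * (t powr (b - 1) * exp (- s * t)))
    (Gamma b * s powr (- b))"
proof -
  define g where "g = (\<lambda>t::real. indicator {0..} t * (t powr (b - 1) / exp t))"
  have "has_bochner_integral lborel g (Gamma b)"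
    unfolding g_def by (intro has_bochner_integral_nonneg_HK Gamma_integral_real b) auto
  then have "has_bochner_integral lborel (\<lambda>t. g (0 + s * t)) (Gamma b /\<^sub>R \<bar>s\<bar>)"
    using s by (subst lborel_has_bochner_integral_real_affine_iff[symmetric]) auto
  \<comment> \<open>The factor \<open>s powr (1 - b)\<close> cancels the power of s that the
    rescaling puts into the kernel.\<close>
  then have "has_bochner_integral lborel (\<lambda>t. s powr (1 - b) * g (s * t)) (s powr (1 - b) * (Gamma b / s))"
    using s by (intro has_bochner_integral_mult_right) (auto simp: divide_simps)
  moreover have "s powr (1 - b) * (Gamma b / s) = Gamma b * s powr (- b)"
    using s by (simp add: powr_diff powr_minus divide_simps)
  moreover have "AE t in lborel. s powr (1 - b) * g (s * t) =
      indicator {0<..} t * (t powr (b - 1) * exp (- s * t))"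
    using AE_lborel_singleton[of 0]
  proof eventually_elim
    case (elim t)
    have "s powr (1 - b) * s powr (b - 1) = 1"
      using s by (simp flip: powr_add)
    with elim s show ?case
      by (auto simp: g_def indicator_def powr_mult exp_minus divide_simps zero_le_mult_iff)
  qed
  ultimately show ?thesis
    by (subst has_bochner_integral_cong_AE[symmetric]) (auto simp: g_def)
qed

text \<open>Splitting exp (- s t) as exp (- s (t - r)) exp (- s r) turns the damped fractional
  integral into a convolution of two integrable functions, so the integrals multiply. The transform
  exists because that of \<open>g\<close> does.\<close>

lemma laplace_frac_integral:
  assumes b: "0 < b" and s: "0 < s" and g: "laplace_integrable g s"
  shows "laplace_integrable (frac_integral b g) s"
    and "laplace (frac_integral b g) s = s powr (- b) * laplace g s"
proof -
  define K where "K = (\<lambda>t::real. indicator {0<..} t * (t powr (b - 1) * exp (- s * t)))"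
  define G where "G = (\<lambda>r::real. indicator {0<..} r * (exp (- s * r) * g r))"
  have K: "integrable lborel K" "(LBINT t. K t) = Gamma b * s powr (- b)"
    using has_bochner_integral_powr_exp[OF b s] by (auto simp: K_def has_bochner_integral_iff)
  have G: "integrable lborel G" "(LBINT r. G r) = laplace g s"
    using g by (auto simp: G_def laplace_integrable_def laplace_def set_integrable_def
        set_lebesgue_integral_def)
  have eq: "indicator {0<..} t * (exp (- s * t) * frac_integral b g t) =
      1 / Gamma b * (LBINT r. K (t - r) * G r)" for t
  proof -
    have "K (t - r) * G r = indicator {0<..} t * exp (- s * t) *
        (indicator {0<..<t} r *\<^sub>R ((t - r) powr (b - 1) * g r))" for r
      by (auto simp: K_def G_def indicator_def algebra_simps simp flip: exp_add)
    then show ?thesis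
      by (simp add: frac_integral_def set_lebesgue_integral_def)
  qed
  show "laplace_integrable (frac_integral b g) s"
    using convolution_integral(1)[OF K(1) G(1)]
    unfolding laplace_integrable_def set_integrable_def by (simp only: eq real_scaleR_def integrable_mult_right)
  have "Gamma b \<noteq> 0"
    using Gamma_real_pos[OF b] by simp
  then show "laplace (frac_integral b g) s = s powr (- b) * laplace g s"
    using convolution_integral(2)[OF K(1) G(1)]
    unfolding laplace_def[of "frac_integral b g"] set_lebesgue_integral_def real_scaleR_def eq
    by (simp add: K(2) G(2))
qed

text \<open>Euler's Beta integral moved from [0, 1] to [s, t]. It evaluates the composition of two
  kernels of fractional integrals; for a + b = 1 the power of t - s disappears.\<close>

lemma has_bochner_integral_Beta_shift:
  fixes a b s t :: real
  assumes a: "0 < a" and b: "0 < b" and st: "s < t"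
  shows "has_bochner_integral lborel
    (\<lambda>r. indicator {s<..<t} r * ((t - r) powr (a - 1) * (r - s) powr (b - 1)))
    (Beta b a * (t - s) powr (a + b - 1))"
proof -
  define c where "c = t - s"
  have c: "0 < c" using st by (simp add: c_def)
  define g where "g = (\<lambda>x::real. indicator {0..1} x * (x powr (b - 1) * (1 - x) powr (a - 1)))"
  have "has_bochner_integral lborel g (Beta b a)"
    unfolding g_def by (intro has_bochner_integral_nonneg_HK has_integral_Beta_real a b) auto
  then have "has_bochner_integral lborel (\<lambda>r. g (- s / c + (1 / c) * r)) (Beta b a /\<^sub>R \<bar>1 / c\<bar>)"
    using c by (subst lborel_has_bochner_integral_real_affine_iff[symmetric]) auto
  then have "has_bochner_integral lborel (\<lambda>r. c powr (a + b - 2) * g ((r - s) / c))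
      (c powr (a + b - 2) * (Beta b a * c))"
    using c by (intro has_bochner_integral_mult_right) (auto simp: diff_divide_distrib mult.commute)
  also have "c powr (a + b - 2) * (Beta b a * c) = Beta b a * c powr (a + b - 1)"
  proof -
    have "c powr ((a + b - 2) + 1) = c powr (a + b - 2) * c"
      using c by (subst powr_add) simp
    then show ?thesis by (simp add: algebra_simps)
  qed
  finally have "has_bochner_integral lborel (\<lambda>r. c powr (a + b - 2) * g ((r - s) / c))
      (Beta b a * c powr (a + b - 1))" .
  moreover have "AE r in lborel. c powr (a + b - 2) * g ((r - s) / c) =
      indicator {s<..<t} r * ((t - r) powr (a - 1) * (r - s) powr (b - 1))"
    using AE_lborel_singleton[of s] AE_lborel_singleton[of t]
  proof eventually_elim
    case (elim r)
    show ?case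
    proof (cases "s < r \<and> r < t")
      case True
      have "1 - (r - s) / c = (t - r) / c"
        using c by (simp add: c_def divide_simps)
      then have "g ((r - s) / c) = ((r - s) / c) powr (b - 1) * ((t - r) / c) powr (a - 1)"
        using True c by (auto simp: g_def indicator_def c_def divide_simps)
      also have "\<dots> = (t - r) powr (a - 1) * (r - s) powr (b - 1) / (c powr (b - 1) * c powr (a - 1))"
        using True c by (simp add: powr_divide)
      also have "c powr (b - 1) * c powr (a - 1) = c powr (a + b - 2)"
        by (simp add: algebra_simps flip: powr_add)
      finally show ?thesis
        using True c by simp
    next
      case False
      then have "r < s \<or> t < r" using elim by auto
      then have "g ((r - s) / c) = 0"
        using c by (auto simp: g_def indicator_def c_def divide_simps)
      with False show ?thesis by simp
    qed
  qed
  ultimately show ?thesis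
    by (subst has_bochner_integral_cong_AE[symmetric]) (auto simp: g_def c_def)
qed

text \<open>Fractional integrals of orders 1 - b and b compose to order 1. After the exchange of
  integrals the inner one is a Beta integral, whose value does not depend on the end points.\<close>

lemma frac_integral_frac_integral:
  assumes b: "0 < b" "b < 1" and h: "set_integrable lborel {0<..<t} h"
  shows "frac_integral b (frac_integral (1 - b) h) t = (LBINT r:{0<..<t}. h r)"
proof -
  define H where "H = (\<lambda>r. indicator {0<..<t} r * h r)"
  have H: "integrable lborel H"
    using h by (simp add: H_def set_integrable_def)
  then have [measurable]: "H \<in> borel_measurable borel"
    by auto
  define F where "F = (\<lambda>s r. indicator {s<..<t} r * ((t - r) powr (b - 1) * (r - s) powr (- b)) * H s)"
  have F_meas: "case_prod F \<in> borel_measurable (lborel \<Otimes>\<^sub>M lborel)"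
  proof -
    have "case_prod F = (\<lambda>(s, r). (if s < r \<and> r < t then 1 else 0) * ((t - r) powr (b - 1) * (r - s) powr (- b)) * H s)"
      by (auto simp: F_def fun_eq_iff)
    then show ?thesis by simp
  qed
  \<comment> \<open>This is Beta (1 - b) b, with Gamma 1 = 1 in the denominator.\<close>
  define B where "B = Gamma b * Gamma (1 - b)"
  have Bta: "has_bochner_integral lborel
      (\<lambda>r. indicator {s<..<t} r * ((t - r) powr (b - 1) * (r - s) powr (- b))) B" if "s < t" for s
    using has_bochner_integral_Beta_shift[of b "1 - b" s t] b that
    by (simp add: B_def Beta_def mult.commute)
  have Fi: "has_bochner_integral lborel (\<lambda>r. F s r) (B * H s)" for s
  proof (cases "s < t")
    case True then show ?thesis
      unfolding F_def by (intro has_bochner_integral_mult_left Bta)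
  qed (simp add: F_def H_def has_bochner_integral_zero)
  \<comment> \<open>The kernel is nonnegative, so absolute values fall on \<open>H\<close> alone;
    this is the integrability that Fubini requires.\<close>
  have Fa: "has_bochner_integral lborel (\<lambda>r. \<bar>F s r\<bar>) (B * \<bar>H s\<bar>)" for s
  proof (cases "s < t")
    case True
    have "(\<lambda>r. \<bar>F s r\<bar>) = (\<lambda>r. indicator {s<..<t} r * ((t - r) powr (b - 1) * (r - s) powr (- b)) * \<bar>H s\<bar>)"
      by (auto simp: F_def abs_mult fun_eq_iff)
    then show ?thesis
      using True by (auto intro!: has_bochner_integral_mult_left Bta)
  qed (simp add: F_def H_def has_bochner_integral_zero)
  have int: "integrable (lborel \<Otimes>\<^sub>M lborel) (case_prod F)"
  proof (rule lborel_pair.Fubini_integrable[OF F_meas])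
    show "integrable lborel (\<lambda>s. LBINT r. norm (case (s, r) of (s, r) \<Rightarrow> F s r))"
      using H Fa by (simp add: has_bochner_integral_iff)
    show "AE s in lborel. integrable lborel (\<lambda>r. case (s, r) of (s, r) \<Rightarrow> F s r)"
      using Fi by (simp add: has_bochner_integral_iff)
  qed
  have "frac_integral b (frac_integral (1 - b) h) t = 1 / Gamma b *
      (LBINT r. 1 / Gamma (1 - b) * (LBINT s. F s r))"
  proof -
    have "indicator {0<..<t} r *\<^sub>R ((t - r) powr (b - 1) * frac_integral (1 - b) h r) =
        1 / Gamma (1 - b) * (LBINT s. F s r)" for r
    proof -
      have "F s r = indicator {0<..<t} r * (t - r) powr (b - 1) *
          (indicator {0<..<r} s *\<^sub>R ((r - s) powr (- b) * h s))" for s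
        by (auto simp: F_def H_def indicator_def)
      then show ?thesis
        by (simp add: frac_integral_def set_lebesgue_integral_def)
    qed
    then show ?thesis
      by (simp add: frac_integral_def[of b] set_lebesgue_integral_def)
  qed
  also have "\<dots> = 1 / B * (LBINT r. LBINT s. F s r)"
    by (simp add: B_def)
  also have "(LBINT r. LBINT s. F s r) = (LBINT s. LBINT r. F s r)"
    by (rule lborel_pair.Fubini_integral[OF int])
  also have "\<dots> = B * (LBINT s. H s)"
    using Fi by (simp add: has_bochner_integral_iff)
  also have "B \<noteq> 0"
    using b by (auto simp: B_def Gamma_eq_zero_iff elim!: nonpos_Ints_cases)
  ultimately show ?thesis
    by (simp add: H_def set_lebesgue_integral_def)
qed

section \<open>Calculus of the Laplace transform\<close>

lemma frac_integral_cong: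
  assumes "\<And>r. 0 < r \<Longrightarrow> r < t \<Longrightarrow> g r = h r"
  shows "frac_integral b g t = frac_integral b h t"
  unfolding frac_integral_def using assms
  by (intro arg_cong2[where f = "(*)"] refl set_lebesgue_integral_cong) auto

lemma frac_integral_1: "frac_integral 1 g t = (LBINT r:{0<..<t}. g r)"
  by (auto simp: frac_integral_def intro!: set_lebesgue_integral_cong)

lemma laplace_integrable_cong:
  assumes "\<And>t. 0 < t \<Longrightarrow> f t = g t"
  shows "laplace_integrable f s \<longleftrightarrow> laplace_integrable g s"
  unfolding laplace_integrable_def using assms by (intro set_integrable_cong) auto

lemma laplace_cong:
  assumes "\<And>t. 0 < t \<Longrightarrow> f t = g t"
  shows "laplace f s = laplace g s"
  unfolding laplace_def using assms by (intro set_lebesgue_integral_cong) auto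

lemma laplace_add:
  assumes "laplace_integrable f s" "laplace_integrable g s"
  shows "laplace_integrable (\<lambda>t. f t + g t) s"
    and "laplace (\<lambda>t. f t + g t) s = laplace f s + laplace g s"
  using set_integral_add[OF assms[unfolded laplace_integrable_def]]
  by (simp_all add: laplace_integrable_def laplace_def distrib_left)

lemma laplace_cmult:
  shows "laplace_integrable f s \<Longrightarrow> laplace_integrable (\<lambda>t. c * f t) s"
    and "laplace (\<lambda>t. c * f t) s = c * laplace f s"
  by (simp_all add: laplace_integrable_def laplace_def mult.left_commute[of _ c])

lemma laplace_const:
  assumes "0 < s"
  shows "laplace_integrable (\<lambda>_. c) s" and "laplace (\<lambda>_. c) s = c / s"
proof -
  have 1: "has_bochner_integral lborel (\<lambda>t. indicator {0<..} t * exp (- s * t)) (1 / s)"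
  proof -
    have "(\<lambda>t. indicator {0<..} t * (t powr (1 - 1) * exp (- s * t))) =
        (\<lambda>t. indicator {0<..} t * exp (- s * t))"
      by (auto simp: indicator_def)
    then show ?thesis
      using has_bochner_integral_powr_exp[of 1 s] assms by (simp add: powr_minus divide_simps)
  qed
  then have "laplace_integrable (\<lambda>_. 1) s" "laplace (\<lambda>_. 1) s = 1 / s"
    by (simp_all add: laplace_integrable_def laplace_def set_integrable_def
        set_lebesgue_integral_def has_bochner_integral_iff)
  from laplace_cmult(1)[OF this(1), of c] laplace_cmult(2)[of c "\<lambda>_. 1" s] this(2)
  show "laplace_integrable (\<lambda>_. c) s" "laplace (\<lambda>_. c) s = c / s"
    by simp_all
qed

lemma laplace_integrable_bounded:
  assumes s: "0 < s" and m: "set_borel_measurable lborel {0<..} f"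
    and B: "\<And>t. 0 < t \<Longrightarrow> \<bar>f t\<bar> \<le> B"
  shows "laplace_integrable f s"
  unfolding laplace_integrable_def set_integrable_def
proof (rule Bochner_Integration.integrable_bound)
  show "integrable lborel (\<lambda>t. indicator {0<..} t *\<^sub>R (exp (- s * t) * B))"
    using laplace_const(1)[OF s, of B] by (simp add: laplace_integrable_def set_integrable_def)
  have "(\<lambda>t. exp (- s * t) * (indicator {0<..} t *\<^sub>R f t)) \<in> borel_measurable lborel"
    using m unfolding set_borel_measurable_def by (intro borel_measurable_times) auto
  then show "(\<lambda>t. indicator {0<..} t *\<^sub>R (exp (- s * t) * f t)) \<in> borel_measurable lborel"
    by (simp add: mult.left_commute)
  show "AE t in lborel. norm (indicator {0<..} t *\<^sub>R (exp (- s * t) * f t))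
      \<le> norm (indicator {0<..} t *\<^sub>R (exp (- s * t) * B))"
    using B by (intro AE_I2) (fastforce simp: indicator_def abs_mult)
qed

text \<open>On a bounded interval the damping factor is at least exp (- s t), so damped
  integrability on the half line implies local integrability.\<close>

lemma laplace_integrable_imp_set_integrable:
  assumes s: "0 < s" and g: "laplace_integrable g s"
  shows "set_integrable lborel {0<..<t} g"
  unfolding set_integrable_def
proof (rule Bochner_Integration.integrable_bound)
  have int: "integrable lborel (\<lambda>r. indicator {0<..} r *\<^sub>R (exp (- s * r) * g r))"
    using g by (simp add: laplace_integrable_def set_integrable_def)
  then show "integrable lborel (\<lambda>r. exp (s * t) * (indicator {0<..} r *\<^sub>R (exp (- s * r) * g r)))"
    by (rule integrable_mult_right)
  have "(\<lambda>r. (indicator {0<..<t} r * exp (s * r)) * (indicator {0<..} r *\<^sub>R (exp (- s * r) * g r)))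
      \<in> borel_measurable lborel"
    using borel_measurable_integrable[OF int] by (intro borel_measurable_times) auto
  also have "(\<lambda>r. (indicator {0<..<t} r * exp (s * r)) * (indicator {0<..} r *\<^sub>R (exp (- s * r) * g r)))
      = (\<lambda>r. indicator {0<..<t} r *\<^sub>R g r)"
    by (auto simp: indicator_def exp_minus)
  finally show "(\<lambda>r. indicator {0<..<t} r *\<^sub>R g r) \<in> borel_measurable lborel" .
  have "\<bar>g r\<bar> \<le> exp (s * t) * (exp (- (s * r)) * \<bar>g r\<bar>)" if "r < t" for r
  proof -
    have "1 \<le> exp (s * t) * exp (- (s * r))"
      using that s by (simp flip: exp_add)
    from mult_right_mono[OF this, of "\<bar>g r\<bar>"] show ?thesis by (simp add: mult.assoc)
  qed
  then show "AE r in lborel. norm (indicator {0<..<t} r *\<^sub>R g r)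
      \<le> norm (exp (s * t) * (indicator {0<..} r *\<^sub>R (exp (- s * r) * g r)))"
    by (intro AE_I2) (auto simp: indicator_def abs_mult)
qed

section \<open>From Caputo equations to Volterra equations\<close>

lemma set_integral_deriv:
  fixes f :: "real \<Rightarrow> real"
  assumes d: "\<And>s. 0 < s \<Longrightarrow> f differentiable at s" and lim: "(f \<longlongrightarrow> f0) (at_right 0)"
    and t: "0 < t" and int: "set_integrable lborel {0<..<t} (deriv f)"
  shows "(LBINT s:{0<..<t}. deriv f s) = f t - f0"
proof -
  \<comment> \<open>The value of \<open>f\<close> at 0 is unconstrained; \<open>F\<close> puts the
    limit \<open>f0\<close> there, to be continuous on the closed interval.\<close>
  define F where "F = (\<lambda>s. if s \<le> 0 then f0 else f s)"
  have "F differentiable at s" "deriv F s = deriv f s" if "0 < s" for s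
  proof -
    have "(f has_real_derivative deriv f s) (at s)"
      using d[OF that] by (simp add: DERIV_deriv_iff_real_differentiable)
    moreover have "\<forall>\<^sub>F x in nhds s. F x = f x"
      using eventually_nhds_in_open[of "{0<..}" s] that
      by (auto simp: F_def elim!: eventually_mono)
    ultimately have "(F has_real_derivative deriv f s) (at s)"
      using DERIV_cong_ev[of s s F f] by auto
    then show "F differentiable at s" "deriv F s = deriv f s"
      by (auto simp: real_differentiable_def DERIV_imp_deriv)
  qed
  note dF = this
  have cont: "continuous_on {0..t} F"
  proof (unfold continuous_on_eq_continuous_within, safe)
    fix x assume x: "x \<in> {0..t}"
    show "continuous (at x within {0..t}) F"
    proof (cases "x = 0")
      case True
      have "\<forall>\<^sub>F s in at_right 0. F s = f s"
        by (auto simp: F_def eventually_at_filter)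
      with lim have "(F \<longlongrightarrow> f0) (at_right 0)"
        by (simp add: tendsto_cong)
      then have "(F \<longlongrightarrow> F 0) (at 0 within {0..t})"
        using t by (simp add: at_within_Icc_at_right F_def)
      with True show ?thesis by (simp add: continuous_within)
    next
      case False
      with x dF(1)[of x] show ?thesis
        by (auto intro!: differentiable_imp_continuous_within differentiable_at_withinI)
    qed
  qed
  \<comment> \<open>The fundamental theorem yields a gauge integral; by the assumed integrability of
    the derivative it is a Lebesgue integral.\<close>
  have "(deriv f has_integral (F t - F 0)) {0..t}"
  proof (rule fundamental_theorem_of_calculus_interior)
    show "(F has_vector_derivative deriv f x) (at x)" if "x \<in> {0<..<t}" for x
      using dF[of x] that
      by (metis DERIV_deriv_iff_real_differentiable greaterThanLessThan_iff
          has_real_derivative_iff_has_vector_derivative)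
  qed (use t cont in auto)
  then have "(deriv f has_integral (f t - f0)) {0<..<t}"
    using t by (simp add: F_def has_integral_Icc_iff_Ioo)
  then show ?thesis
    using set_borel_integral_eq_integral(2)[OF int] by (simp add: integral_unique)
qed

text \<open>The weight is at least t^(-b) on the interval, so it can be removed at the cost of the
  constant \<open>t powr b\<close>.\<close>

lemma set_integrable_weight:
  fixes f :: "real \<Rightarrow> real"
  assumes b: "0 < b" and int: "set_integrable lborel {0<..<t} (\<lambda>s. (t - s) powr (- b) * f s)"
  shows "set_integrable lborel {0<..<t} f"
  unfolding set_integrable_def
proof (rule Bochner_Integration.integrable_bound)
  have int': "integrable lborel (\<lambda>s. indicator {0<..<t} s *\<^sub>R ((t - s) powr (- b) * f s))"
    using int by (simp add: set_integrable_def)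
  then show "integrable lborel (\<lambda>s. t powr b * (indicator {0<..<t} s *\<^sub>R ((t - s) powr (- b) * f s)))"
    by (rule integrable_mult_right)
  have eq: "(t - s) powr b * ((t - s) powr (- b) * f s) = f s" if "s < t" for s
    using that by (simp add: powr_minus)
  have "(\<lambda>s. (t - s) powr b * (indicator {0<..<t} s *\<^sub>R ((t - s) powr (- b) * f s)))
      \<in> borel_measurable lborel"
    using borel_measurable_integrable[OF int'] by (intro borel_measurable_times) auto
  also have "(\<lambda>s. (t - s) powr b * (indicator {0<..<t} s *\<^sub>R ((t - s) powr (- b) * f s)))
      = (\<lambda>s. indicator {0<..<t} s *\<^sub>R f s)"
    using eq by (auto simp: indicator_def)
  finally show "(\<lambda>s. indicator {0<..<t} s *\<^sub>R f s) \<in> borel_measurable lborel" .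
  have "\<bar>f s\<bar> \<le> t powr b * ((t - s) powr (- b) * \<bar>f s\<bar>)" if "0 < s" "s < t" for s
  proof -
    have "\<bar>f s\<bar> = (t - s) powr b * ((t - s) powr (- b) * \<bar>f s\<bar>)"
      using that by (simp add: powr_minus)
    also have "\<dots> \<le> t powr b * ((t - s) powr (- b) * \<bar>f s\<bar>)"
      using that b by (intro mult_right_mono powr_mono2) auto
    finally show ?thesis .
  qed
  then show "AE s in lborel. norm (indicator {0<..<t} s *\<^sub>R f s)
      \<le> norm (t powr b * (indicator {0<..<t} s *\<^sub>R ((t - s) powr (- b) * f s)))"
    by (intro AE_I2) (auto simp: indicator_def abs_mult)
qed

text \<open>Applying the fractional integral of order \<open>b\<close> to the Caputo equation leaves
  the ordinary integral of the derivative of \<open>f\<close>, which is f t - f0.\<close>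

lemma volterra_of_caputo_less_1:
  fixes f g :: "real \<Rightarrow> real"
  assumes b: "0 < b" "b < 1"
    and d: "\<And>s. 0 < s \<Longrightarrow> f differentiable at s" and lim: "(f \<longlongrightarrow> f0) (at_right 0)"
    and int: "\<And>t. 0 < t \<Longrightarrow> set_integrable lborel {0<..<t} (\<lambda>s. (t - s) powr (- b) * deriv f s)"
    and g: "\<And>t. 0 < t \<Longrightarrow> frac_integral (1 - b) (deriv f) t = g t"
    and t: "0 < t"
  shows "f t = f0 + frac_integral b g t"
proof -
  have h: "set_integrable lborel {0<..<t} (deriv f)"
    using set_integrable_weight[OF b(1) int[OF t]] .
  have "frac_integral b g t = frac_integral b (frac_integral (1 - b) (deriv f)) t"
    using g by (intro frac_integral_cong) auto
  also have "\<dots> = f t - f0"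
    using frac_integral_frac_integral[OF b h] set_integral_deriv[OF d lim t h] by simp
  finally show ?thesis by simp
qed

text \<open>The Volterra form of the equation is transformed, not the Caputo derivative: no growth
  bound on \<open>f\<close> is assumed, so the existence of its transform has to come from that of
  \<open>g\<close>.\<close>

lemma laplace_caputo:
  assumes b: "0 < b" "b < 2" and s: "0 < s"
    and f: "has_caputo_derivative b f" and lim: "(f \<longlongrightarrow> f0) (at_right 0)"
    and lim': "1 < b \<Longrightarrow> (deriv f \<longlongrightarrow> 0) (at_right 0)"
    and g: "\<And>t. 0 < t \<Longrightarrow> caputo_derivative b f t = g t" and gi: "laplace_integrable g s"
  shows "laplace_integrable f s \<and> laplace f s = f0 / s + s powr (- b) * laplace g s"
proof -
  have d: "f differentiable at t" if "0 < t" for t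
    using f that by (simp add: has_caputo_derivative_def)
  have conclude: ?thesis
    if h: "laplace_integrable h s" and eq: "\<And>t. 0 < t \<Longrightarrow> f t = f0 + h t"
      and L: "laplace h s = s powr (- b) * laplace g s" for h
    using laplace_add[OF laplace_const(1)[OF s] h, of f0]
    by (simp add: laplace_integrable_cong[OF eq] laplace_cong[OF eq] laplace_const(2)[OF s] L)
  consider "b < 1" | "b = 1" | "1 < b" by linarith
  then show ?thesis
  proof cases
    case 1
    have "f t = f0 + frac_integral b g t" if "0 < t" for t
    proof (rule volterra_of_caputo_less_1[OF b(1) 1 d lim _ _ that])
      show "set_integrable lborel {0<..<t} (\<lambda>s. (t - s) powr (- b) * deriv f s)" if "0 < t" for t
        using f 1 that by (simp add: has_caputo_derivative_def)
      show "frac_integral (1 - b) (deriv f) t = g t" if "0 < t" for t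
        using g[OF that] 1 by (simp add: caputo_derivative_def frac_integral_def)
    qed
    with laplace_frac_integral[OF b(1) s gi] show ?thesis
      by (intro conclude)
  next
    case 2
    have "f t = f0 + frac_integral b g t" if t: "0 < t" for t
    proof -
      have eq: "deriv f r = g r" if "0 < r" for r
        using g[OF that] 2 by (simp add: caputo_derivative_def)
      then have "set_integrable lborel {0<..<t} (deriv f)"
        using laplace_integrable_imp_set_integrable[OF s gi, of t]
        by (subst set_integrable_cong[where f' = g]) auto
      from set_integral_deriv[OF d lim t this] show ?thesis
        using frac_integral_cong[of t "deriv f" g 1] eq by (simp add: 2 frac_integral_1)
    qed
    with laplace_frac_integral[OF b(1) s gi] show ?thesis
      by (intro conclude)
  next
    case 3
    have d': "deriv f differentiable at t" if "0 < t" for t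
      using f that 3 by (simp add: has_caputo_derivative_def)
    \<comment> \<open>An order \<open>b\<close> between 1 and 2 is the order b - 1 for the
      derivative of \<open>f\<close>, which starts at 0; one more integration leads back to
      \<open>f\<close>.\<close>
    have eq: "deriv f t = 0 + frac_integral (b - 1) g t" if "0 < t" for t
    proof (rule volterra_of_caputo_less_1[OF _ _ d' lim'[OF 3] _ _ that])
      show "set_integrable lborel {0<..<t} (\<lambda>s. (t - s) powr (- (b - 1)) * deriv (deriv f) s)"
        if "0 < t" for t
        using f 3 b that by (simp add: has_caputo_derivative_def)
      show "frac_integral (1 - (b - 1)) (deriv (deriv f)) t = g t" if "0 < t" for t
        using g[OF that] 3 b by (simp add: caputo_derivative_def frac_integral_def)
    qed (use b 3 in auto)
    have b1: "0 < b - 1" using 3 by simp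
    have f': "laplace_integrable (deriv f) s"
      "laplace (deriv f) s = s powr (- (b - 1)) * laplace g s"
      using laplace_frac_integral[OF b1 s gi] eq
        laplace_integrable_cong[of "deriv f" "frac_integral (b - 1) g" s]
        laplace_cong[of "deriv f" "frac_integral (b - 1) g" s] by auto
    have "f t = f0 + frac_integral 1 (deriv f) t" if t: "0 < t" for t
      using set_integral_deriv[OF d lim t laplace_integrable_imp_set_integrable[OF s f'(1)]]
      by (simp add: frac_integral_1)
    moreover have "s powr - 1 * s powr (- (b - 1)) = s powr (- b)"
      by (subst powr_add[symmetric]) simp
    ultimately show ?thesis
      using laplace_frac_integral[OF zero_less_one s f'(1)] f'(2)
      by (intro conclude[of "frac_integral 1 (deriv f)"]) (simp_all flip: mult.assoc)
  qed
qed

section \<open>Injectivity of the Laplace transform\<close>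

lemma laplace_sum:
  assumes "finite I" "\<And>i. i \<in> I \<Longrightarrow> laplace_integrable (f i) s"
  shows "laplace_integrable (\<lambda>t. \<Sum>i\<in>I. f i t) s"
    and "laplace (\<lambda>t. \<Sum>i\<in>I. f i t) s = (\<Sum>i\<in>I. laplace (f i) s)"
proof -
  have "laplace_integrable (\<lambda>t. \<Sum>i\<in>I. f i t) s \<and>
      laplace (\<lambda>t. \<Sum>i\<in>I. f i t) s = (\<Sum>i\<in>I. laplace (f i) s)"
    using assms
  proof (induction I)
    case empty
    then show ?case by (simp add: laplace_integrable_def laplace_def set_integrable_def)
  next
    case (insert i I)
    with laplace_add[of "f i" s "\<lambda>t. \<Sum>i\<in>I. f i t"] show ?case by simp
  qed
  then show "laplace_integrable (\<lambda>t. \<Sum>i\<in>I. f i t) s"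
    "laplace (\<lambda>t. \<Sum>i\<in>I. f i t) s = (\<Sum>i\<in>I. laplace (f i) s)" by auto
qed

text \<open>Integrals of \<open>D\<close> against polynomials in \<open>exp (- t)\<close> vanish, so by Weierstrass does its integral
  against \<open>exp (- t) D t\<close> times a positive weight. The weight \<open>y (1 - y)\<close>, \<open>y = exp (- t)\<close>, makes the
  approximated function continuous at the end points.\<close>

lemma laplace_unique:
  fixes D :: "real \<Rightarrow> real"
  assumes cont: "continuous_on {0<..} D" and B: "\<And>t. 0 < t \<Longrightarrow> \<bar>D t\<bar> \<le> B"
    and L: "\<And>s. 0 < s \<Longrightarrow> laplace D s = 0"
    and t: "0 < t"
  shows "D t = 0"
proof -
  have B0: "0 \<le> B" using B[of 1] by simp
  have D_meas: "set_borel_measurable lborel {0<..} D"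
    unfolding set_borel_measurable_def using borel_measurable_continuous_on_indicator[OF _ cont]
    by simp
  have D_int: "laplace_integrable D s" if "0 < s" for s
    using laplace_integrable_bounded[OF that D_meas B] .
  \<comment> \<open>This is \<open>D\<close> in the variable y times the weight. \<open>D\<close>
    may have no limit at 0 or at infinity; its boundedness is enough for continuity of
    \<open>h\<close> at 1 and 0.\<close>
  define h where "h y = (if 0 < y \<and> y < 1 then D (- ln y) * (y * (1 - y)) else 0)" for y :: real
  have h_bound: "\<bar>h y\<bar> \<le> B * \<bar>y * (1 - y)\<bar>" for y
    using B[of "- ln y"] B0 by (auto simp: h_def abs_mult intro!: mult_right_mono)
  have h_cont: "continuous_on {0..1} h"
  proof (unfold continuous_on_def, safe)
    fix x :: real assume x: "x \<in> {0..1}"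
    show "(h \<longlongrightarrow> h x) (at x within {0..1})"
    proof (cases "x \<in> {0<..<1}")
      case True
      have "continuous_on {0<..<1} (\<lambda>y. D (- ln y) * (y * (1 - y)))"
        by (intro continuous_intros continuous_on_compose2[OF cont]) auto
      then have "continuous_on {0<..<1} h"
        by (rule continuous_on_eq) (auto simp: h_def)
      then have "isCont h x"
        using True by (simp add: continuous_on_eq_continuous_at)
      then have "(h \<longlongrightarrow> h x) (at x)"
        by (simp add: isCont_def)
      then show ?thesis
        by (rule tendsto_within_subset) simp
    next
      case False
      with x have "x = 0 \<or> x = 1" by auto
      then have x0: "x * (1 - x) = 0" and hx: "h x = 0" by (auto simp: h_def)
      have "((\<lambda>y. B * \<bar>y * (1 - y)\<bar>) \<longlongrightarrow> B * \<bar>x * (1 - x)\<bar>) (at x within {0..1})"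
        by (intro tendsto_intros)
      then have "((\<lambda>y. B * \<bar>y * (1 - y)\<bar>) \<longlongrightarrow> 0) (at x within {0..1})"
        using x0 by simp
      then show ?thesis
        unfolding hx by (rule Lim_null_comparison[rotated]) (simp add: h_bound)
    qed
  qed
  \<comment> \<open>For t > 0 this is the weight times the square of \<open>D t\<close>, so it
    suffices that its integral against exp (- t) vanishes.\<close>
  define w where "w t = h (exp (- t)) * D t" for t
  have w_nonneg: "0 \<le> w t" if "0 < t" for t
    using that by (auto simp: w_def h_def mult.assoc mult.left_commute[of "D t"])
  have w_cont: "continuous_on {0<..} w"
    unfolding w_def by (intro continuous_intros continuous_on_compose2[OF h_cont] cont) auto
  have w_meas: "set_borel_measurable lborel {0<..} w"
    unfolding set_borel_measurable_def using borel_measurable_continuous_on_indicator[OF _ w_cont]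
    by simp
  have w_int: "laplace_integrable w 1"
  proof (rule laplace_integrable_bounded[OF _ w_meas])
    show "\<bar>w t\<bar> \<le> B * B" if "0 < t" for t
    proof -
      have "\<bar>exp (- t) * (1 - exp (- t))\<bar> \<le> 1"
        using that by (simp add: abs_mult mult_le_one)
      then have "\<bar>h (exp (- t))\<bar> \<le> B"
        using h_bound[of "exp (- t)"] B0 mult_left_mono[of "\<bar>exp (- t) * (1 - exp (- t))\<bar>" 1 B] by simp
      with B[OF that] B0 show ?thesis
        by (auto simp: w_def abs_mult intro!: mult_mono)
    qed
  qed simp
  have "\<bar>laplace w 1\<bar> \<le> \<epsilon>" if \<epsilon>: "0 < \<epsilon>" for \<epsilon>
  proof -
    \<comment> \<open>The summand 1 keeps the denominator positive when \<open>B\<close> is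
      0.\<close>
    define \<delta> where "\<delta> = \<epsilon> / (B + 1)"
    have \<delta>: "0 < \<delta>" "\<delta> * B \<le> \<epsilon>"
      using \<epsilon> B0 by (auto simp: \<delta>_def divide_simps)
    obtain p where p: "real_polynomial_function p" "\<And>x. x \<in> {0..1} \<Longrightarrow> \<bar>h x - p x\<bar> < \<delta>"
      using Stone_Weierstrass_real_polynomial_function[OF _ h_cont \<delta>(1)] by auto
    obtain a n where p_eq: "p = (\<lambda>x. \<Sum>i\<le>n. a i * x ^ i)"
      using p(1) real_polynomial_function_iff_sum by blast
    \<comment> \<open>Every power of y raises the rate of damping by 1, so the term of degree i is a
      Laplace transform of \<open>D\<close> at i + 1, which vanishes.\<close>
    have term_eq: "exp (- 1 * t) * (a i * exp (- t) ^ i * D t) =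
        a i * (exp (- (real i + 1) * t) * D t)" for i t
      by (simp add: exp_of_nat_mult[symmetric] algebra_simps exp_add exp_diff exp_minus divide_simps)
    have term_int: "laplace_integrable (\<lambda>t. a i * exp (- t) ^ i * D t) 1" for i
      using laplace_cmult(1)[OF D_int[of "real i + 1"], of "a i"]
      unfolding laplace_integrable_def term_eq by (simp add: mult.left_commute)
    have term_0: "laplace (\<lambda>t. a i * exp (- t) ^ i * D t) 1 = 0" for i
      using L[of "real i + 1"] laplace_cmult(2)[of "a i" D "real i + 1"]
      unfolding laplace_def term_eq by simp
    have p_int: "laplace_integrable (\<lambda>t. p (exp (- t)) * D t) 1"
      and p_0: "laplace (\<lambda>t. p (exp (- t)) * D t) 1 = 0"
      using laplace_sum[of "{..n}" "\<lambda>i t. a i * exp (- t) ^ i * D t" 1] term_int term_0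
      by (simp_all add: p_eq sum_distrib_right)
    define v where "v t = w t + (- 1) * (p (exp (- t)) * D t)" for t
    have v_int: "laplace_integrable v 1" and v_eq: "laplace v 1 = laplace w 1"
      using laplace_add[OF w_int laplace_cmult(1)[OF p_int, of "-1"]]
      unfolding v_def laplace_cmult(2) p_0 by simp_all
    have v_bound: "\<bar>v t\<bar> \<le> \<epsilon>" if t: "0 < t" for t
    proof -
      have "v t = (h (exp (- t)) - p (exp (- t))) * D t"
        by (simp add: v_def w_def algebra_simps)
      then have "\<bar>v t\<bar> = \<bar>h (exp (- t)) - p (exp (- t))\<bar> * \<bar>D t\<bar>"
        by (simp add: abs_mult)
      also have "\<dots> \<le> \<delta> * B"
        using p(2)[of "exp (- t)"] t B[OF t] \<delta>(1) by (intro mult_mono) auto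
      finally show ?thesis using \<delta>(2) by simp
    qed
    have "\<bar>laplace v 1\<bar> \<le> (LBINT t. \<bar>indicator {0<..} t *\<^sub>R (exp (- 1 * t) * v t)\<bar>)"
      unfolding laplace_def set_lebesgue_integral_def by (rule integral_abs_bound)
    also have "\<dots> \<le> (LBINT t. indicator {0<..} t *\<^sub>R (exp (- 1 * t) * \<epsilon>))"
    proof (rule integral_mono)
      show "integrable lborel (\<lambda>t. \<bar>indicator {0<..} t *\<^sub>R (exp (- 1 * t) * v t)\<bar>)"
        using v_int by (intro integrable_abs) (simp add: laplace_integrable_def set_integrable_def)
      show "integrable lborel (\<lambda>t. indicator {0<..} t *\<^sub>R (exp (- 1 * t) * \<epsilon>))"
        using laplace_const(1)[of 1 \<epsilon>] by (simp add: laplace_integrable_def set_integrable_def)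
      show "\<bar>indicator {0<..} t *\<^sub>R (exp (- 1 * t) * v t)\<bar> \<le> indicator {0<..} t *\<^sub>R (exp (- 1 * t) * \<epsilon>)" for t
        using v_bound[of t] by (auto simp: indicator_def abs_mult)
    qed
    also have "\<dots> = laplace (\<lambda>_. \<epsilon>) 1"
      by (simp only: laplace_def set_lebesgue_integral_def)
    also have "\<dots> = \<epsilon>"
      by (simp add: laplace_const(2))
    finally show ?thesis by (simp add: v_eq)
  qed
  then have "laplace w 1 = 0"
    using field_le_epsilon[of "\<bar>laplace w 1\<bar>" 0] by simp
  then have "AE t in lborel. indicator {0<..} t *\<^sub>R (exp (- 1 * t) * w t) = 0"
    using w_int w_nonneg unfolding laplace_def set_lebesgue_integral_def laplace_integrable_def set_integrable_def
    by (subst (asm) integral_nonneg_eq_0_iff_AE) (auto simp: indicator_def)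
  then have AE: "AE t in lborel. t \<notin> {t \<in> {0<..}. D t \<noteq> 0}"
    by eventually_elim (auto simp: w_def h_def indicator_def)
  \<comment> \<open>By continuity the exceptional null set is open, hence empty; this turns almost
    everywhere into everywhere.\<close>
  have op: "open {t \<in> {0<..}. D t \<noteq> 0}"
    using continuous_open_preimage[OF cont, of "- {0}"] by (simp add: vimage_def Int_def open_Compl)
  then have "{t \<in> {0<..}. D t \<noteq> 0} \<in> null_sets lborel"
    using AE AE_iff_null_sets[of "{t \<in> {0<..}. D t \<noteq> 0}" lborel] by simp
  then have "negligible {t \<in> {0<..}. D t \<noteq> 0}"
    by (simp add: negligible_iff_null_sets null_sets_completionI)
  with op have "{t \<in> {0<..}. D t \<noteq> 0} = {}"
    using open_not_negligible by blast
  with t show ?thesis by auto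
qed

section \<open>Finite measures on the half line\<close>

lemma DERIV_max_0_power:
  "((\<lambda>x::real. max 0 x ^ Suc (Suc n)) has_real_derivative real (Suc (Suc n)) * max 0 x ^ Suc n) (at x)"
proof -
  consider "x < 0" | "x = 0" | "0 < x" by linarith
  then show ?thesis
  proof cases
    case 1
    have "((\<lambda>x::real. 0) has_real_derivative 0) (at x)" by simp
    then have "((\<lambda>x::real. max 0 x ^ Suc (Suc n)) has_real_derivative 0) (at x)"
      by (rule has_field_derivative_transform_within_open[of _ _ _ "{..<0}"]) (use 1 in auto)
    with 1 show ?thesis by simp
  next
    case 2
    show ?thesis
      \<comment> \<open>At 0 the difference quotient is the positive part to the power
        \<open>Suc n\<close>. It is continuous, so Caratheodory's criterion treats both sides at
        once.\<close>
      unfolding CARAT_DERIV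
    proof (intro exI conjI allI)
      show "isCont (\<lambda>z::real. max 0 z ^ Suc n) x"
        by (intro continuous_intros)
    qed (auto simp: 2 max_def)
  next
    case 3
    have "((\<lambda>x::real. x ^ Suc (Suc n)) has_real_derivative real (Suc (Suc n)) * x ^ Suc n) (at x)"
      using DERIV_pow[of "Suc (Suc n)" x] by simp
    then have "((\<lambda>x::real. max 0 x ^ Suc (Suc n)) has_real_derivative real (Suc (Suc n)) * x ^ Suc n) (at x)"
      by (rule has_field_derivative_transform_within_open[of _ _ _ "{0<..}"]) (use 3 in auto)
    with 3 show ?thesis by simp
  qed
qed

lemma DERIV_max_0_cube: "((\<lambda>x::real. max 0 x ^ 3) has_real_derivative 3 * (max 0 x)\<^sup>2) (at x)"
  and DERIV_max_0_square: "((\<lambda>x::real. (max 0 x)\<^sup>2) has_real_derivative 2 * max 0 x) (at x)"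
  using DERIV_max_0_power[of 1 x] DERIV_max_0_power[of 0 x] by (simp_all add: numeral_eq_Suc)

lemmas DERIV_max_0_cube_chain = DERIV_chain2[OF DERIV_max_0_cube]
lemmas DERIV_max_0_square_chain = DERIV_chain2[OF DERIV_max_0_square]

text \<open>Vanishes for |x| >= R and tends to 1 as \<open>R\<close> grows. The third power is the
  least integral one with a continuous second derivative, as test functions require.\<close>

definition outer_cutoff :: "real \<Rightarrow> real \<Rightarrow> real" where
  "outer_cutoff R x = max 0 (1 - (x / R)\<^sup>2) ^ 3"

definition outer_cutoff' :: "real \<Rightarrow> real \<Rightarrow> real" where
  "outer_cutoff' R x = 3 * max 0 (1 - (x / R)\<^sup>2) ^ 2 * (- 2 * x / R\<^sup>2)"

definition outer_cutoff'' :: "real \<Rightarrow> real \<Rightarrow> real" where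
  "outer_cutoff'' R x = 6 * max 0 (1 - (x / R)\<^sup>2) * (2 * x / R\<^sup>2)\<^sup>2
     - 6 / R\<^sup>2 * max 0 (1 - (x / R)\<^sup>2) ^ 2"

text \<open>A function of e / x alone on the positive half line, so that x times its derivative is
  bounded independently of \<open>e\<close>. For fixed positive x it tends to 1 as \<open>e\<close>
  goes to 0.\<close>

definition inner_cutoff :: "real \<Rightarrow> real \<Rightarrow> real" where
  "inner_cutoff e x = (if 0 < x then max 0 (1 - e / x) ^ 3 else 0)"

definition inner_cutoff' :: "real \<Rightarrow> real \<Rightarrow> real" where
  "inner_cutoff' e x = 3 * max 0 (1 - e / x) ^ 2 * (e / x\<^sup>2)"

definition inner_cutoff'' :: "real \<Rightarrow> real \<Rightarrow> real" where
  "inner_cutoff'' e x = 6 * max 0 (1 - e / x) * (e / x\<^sup>2)\<^sup>2 - 6 * e / x ^ 3 * max 0 (1 - e / x) ^ 2"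

lemma DERIV_outer_cutoff:
  assumes "R \<noteq> 0"
  shows "(outer_cutoff R has_real_derivative outer_cutoff' R x) (at x)"
    and "(outer_cutoff' R has_real_derivative outer_cutoff'' R x) (at x)"
proof -
  have d: "((\<lambda>x. 1 - (x / R)\<^sup>2) has_real_derivative - 2 * x / R\<^sup>2) (at x)" for x
    using assms by (auto intro!: derivative_eq_intros simp: power2_eq_square divide_simps)
  show "(outer_cutoff R has_real_derivative outer_cutoff' R x) (at x)"
    unfolding outer_cutoff_def[abs_def] outer_cutoff'_def
    by (rule DERIV_cong[OF DERIV_max_0_cube_chain[OF d]]) simp
  have "((\<lambda>x. 3 * max 0 (1 - (x / R)\<^sup>2) ^ 2 * (- 2 * x / R\<^sup>2)) has_real_derivative
      3 * (2 * max 0 (1 - (x / R)\<^sup>2) * (- 2 * x / R\<^sup>2)) * (- 2 * x / R\<^sup>2)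
        + (- 2 / R\<^sup>2) * (3 * max 0 (1 - (x / R)\<^sup>2) ^ 2)) (at x)"
    using assms
    by (intro DERIV_mult DERIV_cmult DERIV_max_0_square_chain d)
      (auto intro!: derivative_eq_intros simp: power2_eq_square)
  then show "(outer_cutoff' R has_real_derivative outer_cutoff'' R x) (at x)"
    unfolding outer_cutoff'_def[abs_def] outer_cutoff''_def
    by (rule DERIV_cong) (simp add: power2_eq_square)
qed

lemma DERIV_inner_cutoff:
  assumes "0 < x"
  shows "(inner_cutoff e has_real_derivative inner_cutoff' e x) (at x)"
    and "(inner_cutoff' e has_real_derivative inner_cutoff'' e x) (at x)"
proof -
  have d: "((\<lambda>x. 1 - e / x) has_real_derivative e / x\<^sup>2) (at x)"
    using assms by (auto intro!: derivative_eq_intros simp: power2_eq_square)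
  have d2: "((\<lambda>x. e / x\<^sup>2) has_real_derivative - 2 * e / x ^ 3) (at x)"
    using assms by (auto intro!: derivative_eq_intros simp: power2_eq_square power3_eq_cube divide_simps)
  have "((\<lambda>x. max 0 (1 - e / x) ^ 3) has_real_derivative inner_cutoff' e x) (at x)"
    unfolding inner_cutoff'_def by (rule DERIV_cong[OF DERIV_max_0_cube_chain[OF d]]) simp
  then show "(inner_cutoff e has_real_derivative inner_cutoff' e x) (at x)"
    by (rule has_field_derivative_transform_within_open[of _ _ _ "{0<..}"])
      (use assms in \<open>auto simp: inner_cutoff_def\<close>)
  have "((\<lambda>x. 3 * max 0 (1 - e / x) ^ 2 * (e / x\<^sup>2)) has_real_derivative
      3 * (2 * max 0 (1 - e / x) * (e / x\<^sup>2)) * (e / x\<^sup>2)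
        + (- 2 * e / x ^ 3) * (3 * max 0 (1 - e / x) ^ 2)) (at x)"
    by (intro DERIV_mult DERIV_cmult DERIV_max_0_square_chain d d2)
  then show "(inner_cutoff' e has_real_derivative inner_cutoff'' e x) (at x)"
    unfolding inner_cutoff'_def[abs_def] inner_cutoff''_def
    by (rule DERIV_cong) (simp add: power2_eq_square)
qed

lemma outer_cutoff_bounds:
  "0 \<le> outer_cutoff R x" "outer_cutoff R x \<le> 1"
  by (auto simp: outer_cutoff_def intro!: power_le_one)

lemma inner_cutoff_bounds:
  assumes "0 \<le> e"
  shows "0 \<le> inner_cutoff e x" "inner_cutoff e x \<le> 1"
  using assms by (auto simp: inner_cutoff_def intro!: power_le_one)

lemma inner_cutoff_eq_0: "0 < e \<Longrightarrow> x \<le> e \<Longrightarrow> inner_cutoff e x = 0"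
  by (auto simp: inner_cutoff_def max_def divide_simps)

text \<open>Where the positive part is nonzero, |x| < R. For R >= 1 this gives |2 x / R^2| <= 2,
  whence 6 = 3 * 2 for the first derivative and 30 = 6 * 4 + 6 for the second.\<close>

lemma outer_cutoff_derivs_bounds:
  assumes "1 \<le> R"
  shows "\<bar>outer_cutoff' R x\<bar> \<le> 6" and "\<bar>outer_cutoff'' R x\<bar> \<le> 30"
proof -
  define m where "m = max 0 (1 - (x / R)\<^sup>2)"
  have m: "0 \<le> m" "m \<le> 1" by (auto simp: m_def)
  have m2: "0 \<le> m\<^sup>2" "m\<^sup>2 \<le> 1" using m by (auto intro: power_le_one)
  have R2: "1 \<le> R\<^sup>2" "R \<le> R\<^sup>2" using assms by (auto simp: one_le_power self_le_power)
  have R2': "6 / R\<^sup>2 \<le> 6" using R2 by (simp add: divide_simps)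
  show "\<bar>outer_cutoff' R x\<bar> \<le> 6"
  proof (cases "m = 0")
    case False
    then have "(x / R)\<^sup>2 < 1" by (auto simp: m_def max_def split: if_splits)
    then have "\<bar>x / R\<bar> < 1" by (simp add: abs_square_less_1)
    then have "\<bar>x\<bar> < R" using assms by simp
    then have "\<bar>- 2 * x / R\<^sup>2\<bar> \<le> 2"
      using R2 assms by (simp add: abs_mult divide_simps)
    then have "\<bar>3 * m\<^sup>2 * (- 2 * x / R\<^sup>2)\<bar> \<le> 3 * 1 * 2"
      using m2 unfolding abs_mult by (intro mult_mono) auto
    then show ?thesis by (simp add: outer_cutoff'_def m_def)
  qed (simp add: outer_cutoff'_def m_def)
  show "\<bar>outer_cutoff'' R x\<bar> \<le> 30"
  proof (cases "m = 0")
    case False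
    then have "(x / R)\<^sup>2 < 1" by (auto simp: m_def max_def split: if_splits)
    moreover have "(2 * x / R\<^sup>2)\<^sup>2 = 4 / R\<^sup>2 * (x / R)\<^sup>2"
      by (simp add: power_divide power_mult_distrib power2_eq_square)
    moreover have "4 / R\<^sup>2 \<le> 4" using R2 by (simp add: divide_simps)
    ultimately have "(2 * x / R\<^sup>2)\<^sup>2 \<le> 4 * 1"
      by (simp only:) (intro mult_mono, auto)
    then have "m * (2 * x / R\<^sup>2)\<^sup>2 \<le> 1 * 4" using m by (intro mult_mono) auto
    moreover have "6 / R\<^sup>2 * m\<^sup>2 \<le> 6 * 1" using m2 R2' by (intro mult_mono) auto
    moreover have "0 \<le> m * (2 * x / R\<^sup>2)\<^sup>2" "0 \<le> 6 / R\<^sup>2 * m\<^sup>2" using m by auto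
    ultimately show ?thesis
      unfolding outer_cutoff''_def m_def[symmetric] mult.assoc by linarith
  qed (simp add: outer_cutoff''_def m_def)
qed

text \<open>Derivatives of \<open>\<psi>\<close> are given on the open half line. On the overlap (0,
  e) the product is 0, so it glues with the zero function to a twice differentiable function on the
  line.\<close>

lemma test_function_cutoff:
  fixes \<psi> \<psi>' \<psi>'' :: "real \<Rightarrow> real"
  assumes R: "0 < R" and e: "0 < e" and zero: "\<And>x. x \<le> e \<Longrightarrow> \<psi> x = 0"
    and d: "\<And>x. 0 < x \<Longrightarrow> (\<psi> has_real_derivative \<psi>' x) (at x)"
    and d': "\<And>x. 0 < x \<Longrightarrow> (\<psi>' has_real_derivative \<psi>'' x) (at x)"
    and cont: "continuous_on {0<..} \<psi>''"
  shows "test_function (\<lambda>x. \<psi> x * outer_cutoff R x)"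
    and "deriv (deriv (\<lambda>x. \<psi> x * outer_cutoff R x)) x = (if 0 < x then
      \<psi>'' x * outer_cutoff R x + 2 * \<psi>' x * outer_cutoff' R x + \<psi> x * outer_cutoff'' R x else 0)"
proof -
  let ?c = "outer_cutoff R" and ?c' = "outer_cutoff' R" and ?c'' = "outer_cutoff'' R"
  have R': "R \<noteq> 0" using R by simp
  note dc = DERIV_outer_cutoff[OF R']
  have zero_deriv: "(g has_real_derivative 0) (at x)" if "\<And>y. y < e \<Longrightarrow> g y = 0" "x < e" for g x
  proof -
    have "((\<lambda>_. 0) has_real_derivative 0) (at x)" by simp
    then show ?thesis
      by (rule has_field_derivative_transform_within_open[of _ _ _ "{..<e}"]) (use that in auto)
  qed
  define \<phi> where "\<phi> = (\<lambda>x. \<psi> x * ?c x)"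
  define \<phi>' where "\<phi>' x = (if 0 < x then \<psi>' x * ?c x + \<psi> x * ?c' x else 0)" for x
  define \<phi>'' where "\<phi>'' x = (if 0 < x then \<psi>'' x * ?c x + 2 * \<psi>' x * ?c' x + \<psi> x * ?c'' x else 0)" for x
  have z: "\<phi> x = 0" if "x < e" for x using zero[of x] that by (simp add: \<phi>_def)
  have z0: "\<psi>' x = 0" if "0 < x" "x < e" for x
    using DERIV_unique[OF d[OF that(1)] zero_deriv[of \<psi>]] that zero by force
  have z': "\<phi>' x = 0" if "x < e" for x using zero[of x] z0[of x] that by (simp add: \<phi>'_def)
  have D: "(\<phi> has_real_derivative \<phi>' x) (at x)" for x
  proof (cases "0 < x")
    case True
    show ?thesis
      unfolding \<phi>_def by (rule DERIV_cong[OF DERIV_mult[OF d[OF True] dc(1)]]) (simp add: True \<phi>'_def)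
  next
    case False
    then show ?thesis using zero_deriv[of \<phi> x] z z'[of x] e by simp
  qed
  have D': "(\<phi>' has_real_derivative \<phi>'' x) (at x)" for x
  proof (cases "0 < x")
    case True
    have "((\<lambda>x. \<psi>' x * ?c x + \<psi> x * ?c' x) has_real_derivative \<phi>'' x) (at x)"
      by (rule DERIV_cong[OF DERIV_add[OF DERIV_mult[OF d'[OF True] dc(1)] DERIV_mult[OF d[OF True] dc(2)]]])
        (simp add: True \<phi>''_def)
    then show ?thesis
      by (rule has_field_derivative_transform_within_open[of _ _ _ "{0<..}"])
        (use True in \<open>auto simp: \<phi>'_def\<close>)
  next
    case False
    then show ?thesis using zero_deriv[of \<phi>' x] z' e by (simp add: \<phi>''_def)
  qed
  have z'': "\<phi>'' x = 0" if "x < e" for x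
    using DERIV_unique[OF D' zero_deriv[of \<phi>' x]] z' that by simp
  have c_cont: "continuous_on S ?c" "continuous_on S ?c'" "continuous_on S ?c''" for S
    unfolding outer_cutoff_def outer_cutoff'_def outer_cutoff''_def using R' by (auto intro!: continuous_intros)
  have psi_cont: "continuous_on {0<..} \<psi>" "continuous_on {0<..} \<psi>'"
    using d d' by (auto intro!: continuous_at_imp_continuous_on DERIV_isCont)
  have "continuous_on {0<..} (\<lambda>x. \<psi>'' x * ?c x + 2 * \<psi>' x * ?c' x + \<psi> x * ?c'' x)"
    by (intro continuous_intros cont psi_cont c_cont)
  then have "continuous_on {0<..} \<phi>''"
    by (rule continuous_on_eq) (auto simp: \<phi>''_def)
  moreover have "continuous_on {..<e} \<phi>''"
    by (rule continuous_on_eq[of _ "\<lambda>_. 0"]) (auto simp: z'')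
  ultimately have "continuous_on ({0<..} \<union> {..<e}) \<phi>''"
    by (intro continuous_on_open_Un) auto
  moreover have "{0<..} \<union> {..<e} = UNIV" using e by auto
  ultimately have cont'': "continuous_on UNIV \<phi>''" by simp
  have der: "deriv \<phi> = \<phi>'" "deriv \<phi>' = \<phi>''"
    using D D' by (auto intro!: DERIV_imp_deriv)
  have "\<phi> x = 0" if "R < \<bar>x\<bar>" for x
  proof -
    have "R\<^sup>2 < x\<^sup>2" using power_strict_mono[OF that, of 2] R by simp
    then have "1 - (x / R)\<^sup>2 \<le> 0" using R by (simp add: power_divide divide_simps)
    then show ?thesis by (simp add: \<phi>_def outer_cutoff_def)
  qed
  then have "test_function \<phi>"
    unfolding test_function_def der using D D' cont''
    by (auto simp: real_differentiable_def)
  then show "test_function (\<lambda>x. \<psi> x * ?c x)" by (simp add: \<phi>_def)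
  show "deriv (deriv (\<lambda>x. \<psi> x * ?c x)) x = (if 0 < x then
      \<psi>'' x * ?c x + 2 * \<psi>' x * ?c' x + \<psi> x * ?c'' x else 0)"
    unfolding \<phi>_def[symmetric] der by (simp add: \<phi>''_def)
qed

section \<open>Integrals over the half line\<close>

lemma half_line_measurable:
  fixes g :: "real \<Rightarrow> real"
  assumes "sets \<nu> = sets borel" "continuous_on {0<..} g"
  shows "(\<lambda>x. indicator {0<..} x * g x) \<in> borel_measurable \<nu>"
proof -
  have "(\<lambda>x. indicator {0<..} x * g x) \<in> borel_measurable borel"
    using borel_measurable_continuous_on_indicator[OF _ assms(2)] by simp
  then show ?thesis
    using measurable_cong_sets[OF assms(1) refl] by blast
qed

text \<open>Integrands are controlled at positive arguments; the indicator discards all others, so a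
  bound there suffices for a finite measure.\<close>

lemma half_line_integrable:
  fixes g :: "real \<Rightarrow> real"
  assumes "finite_measure \<nu>" "sets \<nu> = sets borel" "continuous_on {0<..} g"
    and B: "\<And>x. 0 < x \<Longrightarrow> \<bar>g x\<bar> \<le> C"
  shows "integrable \<nu> (\<lambda>x. indicator {0<..} x * g x)"
proof -
  interpret finite_measure \<nu> by fact
  have "0 \<le> C" using B[of 1] by simp
  with B show ?thesis
    by (intro integrable_const_bound[where B = C] half_line_measurable assms AE_I2) (auto simp: indicator_def)
qed

lemma half_line_dominated_convergence:
  fixes g :: "real \<Rightarrow> real"
  assumes "finite_measure \<nu>" "sets \<nu> = sets borel"
    and "\<And>k. continuous_on {0<..} (s k)" "continuous_on {0<..} g"
    and B: "\<And>k x. 0 < x \<Longrightarrow> \<bar>s k x\<bar> \<le> C"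
    and lim: "\<And>x. 0 < x \<Longrightarrow> (\<lambda>k. s k x) \<longlonglongrightarrow> g x"
  shows "(\<lambda>k. \<integral>x. indicator {0<..} x * s k x \<partial>\<nu>) \<longlonglongrightarrow> (\<integral>x. indicator {0<..} x * g x \<partial>\<nu>)"
proof -
  interpret finite_measure \<nu> by fact
  have "0 \<le> C" using B[of 1] by (meson abs_ge_zero order_trans zero_less_one)
  show ?thesis
  proof (rule integral_dominated_convergence[where w = "\<lambda>_. C"])
    show "AE x in \<nu>. (\<lambda>k. indicator {0<..} x * s k x) \<longlonglongrightarrow> indicator {0<..} x * g x"
      using lim by (intro AE_I2) (auto simp: indicator_def)
    show "AE x in \<nu>. norm (indicator {0<..} x * s k x) \<le> C" for k
      using B[of _ k] \<open>0 \<le> C\<close> by (intro AE_I2) (auto simp: indicator_def)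
  qed (use assms half_line_measurable in auto)
qed

lemma outer_cutoff_limits:
  "(\<lambda>k. outer_cutoff (real (Suc k)) x) \<longlonglongrightarrow> 1"
  "(\<lambda>k. outer_cutoff' (real (Suc k)) x) \<longlonglongrightarrow> 0"
  "(\<lambda>k. outer_cutoff'' (real (Suc k)) x) \<longlonglongrightarrow> 0"
proof -
  define c where "c k = inverse (real (Suc k))" for k
  have c: "c \<longlonglongrightarrow> 0" unfolding c_def by (rule LIMSEQ_inverse_real_of_nat)
  have "(\<lambda>k. max 0 (1 - (x * c k)\<^sup>2) ^ 3) \<longlonglongrightarrow> max 0 (1 - (x * 0)\<^sup>2) ^ 3"
    by (intro tendsto_intros c)
  then show "(\<lambda>k. outer_cutoff (real (Suc k)) x) \<longlonglongrightarrow> 1"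
    by (simp add: outer_cutoff_def c_def divide_inverse)
  have "(\<lambda>k. 3 * max 0 (1 - (x * c k)\<^sup>2) ^ 2 * (- 2 * x * (c k)\<^sup>2)) \<longlonglongrightarrow>
      3 * max 0 (1 - (x * 0)\<^sup>2) ^ 2 * (- 2 * x * 0\<^sup>2)"
    by (intro tendsto_intros c)
  then show "(\<lambda>k. outer_cutoff' (real (Suc k)) x) \<longlonglongrightarrow> 0"
    by (simp add: outer_cutoff'_def c_def divide_inverse power_inverse)
  have "(\<lambda>k. 6 * max 0 (1 - (x * c k)\<^sup>2) * (2 * x * (c k)\<^sup>2)\<^sup>2
     - 6 * (c k)\<^sup>2 * max 0 (1 - (x * c k)\<^sup>2) ^ 2) \<longlonglongrightarrow>
     6 * max 0 (1 - (x * 0)\<^sup>2) * (2 * x * 0\<^sup>2)\<^sup>2 - 6 * 0\<^sup>2 * max 0 (1 - (x * 0)\<^sup>2) ^ 2"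
    by (intro tendsto_intros c)
  then show "(\<lambda>k. outer_cutoff'' (real (Suc k)) x) \<longlonglongrightarrow> 0"
    by (simp add: outer_cutoff''_def c_def divide_inverse power_inverse)
qed

lemma outer_cutoff_continuous:
  "R \<noteq> 0 \<Longrightarrow> continuous_on S (outer_cutoff R)"
  "R \<noteq> 0 \<Longrightarrow> continuous_on S (outer_cutoff' R)"
  "R \<noteq> 0 \<Longrightarrow> continuous_on S (outer_cutoff'' R)"
  unfolding outer_cutoff_def outer_cutoff'_def outer_cutoff''_def
  by (auto intro!: continuous_intros)

lemma inner_cutoff_limits:
  assumes "0 < x"
  shows "(\<lambda>k. inner_cutoff (inverse (real (Suc k))) x) \<longlonglongrightarrow> 1"
    and "(\<lambda>k. inner_cutoff' (inverse (real (Suc k))) x) \<longlonglongrightarrow> 0"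
proof -
  define c where "c k = inverse (real (Suc k))" for k
  have c: "c \<longlonglongrightarrow> 0" unfolding c_def by (rule LIMSEQ_inverse_real_of_nat)
  have "(\<lambda>k. max 0 (1 - c k / x) ^ 3) \<longlonglongrightarrow> max 0 (1 - 0 / x) ^ 3"
    using assms by (intro tendsto_intros c) auto
  then show "(\<lambda>k. inner_cutoff (inverse (real (Suc k))) x) \<longlonglongrightarrow> 1"
    using assms by (simp add: inner_cutoff_def c_def)
  have "(\<lambda>k. 3 * max 0 (1 - c k / x) ^ 2 * (c k / x\<^sup>2)) \<longlonglongrightarrow> 3 * max 0 (1 - 0 / x) ^ 2 * (0 / x\<^sup>2)"
    using assms by (intro tendsto_intros c) auto
  then show "(\<lambda>k. inner_cutoff' (inverse (real (Suc k))) x) \<longlonglongrightarrow> 0"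
    by (simp add: inner_cutoff'_def c_def)
qed

text \<open>The product equals 3 times the square of the positive part times e / x, and e / x <= 1
  on the support.\<close>

lemma inner_cutoff'_bound:
  assumes e: "0 \<le> e" and x: "0 < x"
  shows "\<bar>x * inner_cutoff' e x\<bar> \<le> 3"
proof (cases "e \<le> x")
  case True
  then have m: "0 \<le> max 0 (1 - e / x)" "max 0 (1 - e / x) \<le> 1" and ex: "0 \<le> e / x" "e / x \<le> 1"
    using e x by auto
  have "x * inner_cutoff' e x = 3 * (max 0 (1 - e / x) ^ 2 * (e / x))"
    using x by (simp add: inner_cutoff'_def power2_eq_square)
  also have "\<bar>\<dots>\<bar> \<le> 3"
    using m ex mult_le_one[OF power_le_one[OF m] ex, of 2] e x by (simp add: abs_mult divide_simps)
  finally show ?thesis .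
next
  case False
  then have "1 - e / x \<le> 0" using x by simp
  then show ?thesis by (simp add: inner_cutoff'_def)
qed

lemma inner_cutoff_continuous:
  "continuous_on {0<..} (inner_cutoff e)"
  "continuous_on {0<..} (inner_cutoff' e)"
  using DERIV_inner_cutoff by (auto intro!: continuous_at_imp_continuous_on DERIV_isCont)

text \<open>The equation extends from compactly supported test functions to bounded ones by removing
  the outer cutoff: its derivatives are bounded and tend to 0 pointwise, and constants are
  integrable because \<open>\<nu>\<close> is finite.\<close>

lemma half_line_resolvent:
  fixes \<nu> :: "real measure" and \<kappa> :: real
  assumes fin: "finite_measure \<nu>" and sets: "sets \<nu> = sets borel"
    and eq: "\<And>\<phi> e. test_function \<phi> \<Longrightarrow> 0 < e \<Longrightarrow> (\<And>x. x \<le> e \<Longrightarrow> \<phi> x = 0) \<Longrightarrow>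
      \<kappa>\<^sup>2 * (\<integral>x. \<phi> x \<partial>\<nu>) = (\<integral>x. deriv (deriv \<phi>) x \<partial>\<nu>)"
    and e: "0 < e" and zero: "\<And>x. x \<le> e \<Longrightarrow> \<psi> x = 0"
    and d: "\<And>x. 0 < x \<Longrightarrow> (\<psi> has_real_derivative \<psi>' x) (at x)"
    and d': "\<And>x. 0 < x \<Longrightarrow> (\<psi>' has_real_derivative \<psi>'' x) (at x)"
    and cont: "continuous_on {0<..} \<psi>''"
    and B: "\<And>x. 0 < x \<Longrightarrow> \<bar>\<psi> x\<bar> \<le> C" "\<And>x. 0 < x \<Longrightarrow> \<bar>\<psi>' x\<bar> \<le> C"
      "\<And>x. 0 < x \<Longrightarrow> \<bar>\<psi>'' x\<bar> \<le> C"
  shows "\<kappa>\<^sup>2 * (\<integral>x. indicator {0<..} x * \<psi> x \<partial>\<nu>) = (\<integral>x. indicator {0<..} x * \<psi>'' x \<partial>\<nu>)"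
proof -
  define R where "R k = real (Suc k)" for k
  have R: "1 \<le> R k" "0 < R k" "R k \<noteq> 0" for k by (auto simp: R_def)
  have C: "0 \<le> C" using B(1)[of 1] by simp
  define s where "s k x = \<psi> x * outer_cutoff (R k) x" for k x
  define s'' where "s'' k x = \<psi>'' x * outer_cutoff (R k) x + 2 * \<psi>' x * outer_cutoff' (R k) x
      + \<psi> x * outer_cutoff'' (R k) x" for k x
  have psi_cont: "continuous_on {0<..} \<psi>" "continuous_on {0<..} \<psi>'"
    using d d' by (auto intro!: continuous_at_imp_continuous_on DERIV_isCont)
  have step: "\<kappa>\<^sup>2 * (\<integral>x. indicator {0<..} x * s k x \<partial>\<nu>) = (\<integral>x. indicator {0<..} x * s'' k x \<partial>\<nu>)" for k
  proof -
    have T: "test_function (\<lambda>x. \<psi> x * outer_cutoff (R k) x)"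
      "deriv (deriv (\<lambda>x. \<psi> x * outer_cutoff (R k) x)) x = (if 0 < x then s'' k x else 0)" for x
      unfolding s''_def by (rule test_function_cutoff[of _ e _ \<psi>' \<psi>'']; fact R(2) e zero d d' cont)+
    have "\<kappa>\<^sup>2 * (\<integral>x. \<psi> x * outer_cutoff (R k) x \<partial>\<nu>)
        = (\<integral>x. deriv (deriv (\<lambda>x. \<psi> x * outer_cutoff (R k) x)) x \<partial>\<nu>)"
      by (rule eq[OF T(1) e]) (auto simp: zero)
    also have "\<dots> = (\<integral>x. indicator {0<..} x * s'' k x \<partial>\<nu>)"
      unfolding T(2) by (intro Bochner_Integration.integral_cong) auto
    also have "(\<integral>x. \<psi> x * outer_cutoff (R k) x \<partial>\<nu>) = (\<integral>x. indicator {0<..} x * s k x \<partial>\<nu>)"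
      using e by (intro Bochner_Integration.integral_cong) (auto simp: s_def indicator_def zero)
    finally show ?thesis .
  qed
  have oc: "\<bar>outer_cutoff (R k) x\<bar> \<le> 1" for k x
    using outer_cutoff_bounds[of "R k" x] by simp
  note oc' = outer_cutoff_derivs_bounds[OF R(1)]
  have "(\<lambda>k. \<integral>x. indicator {0<..} x * s k x \<partial>\<nu>) \<longlonglongrightarrow> (\<integral>x. indicator {0<..} x * \<psi> x \<partial>\<nu>)"
  proof (rule half_line_dominated_convergence[OF fin sets])
    show "continuous_on {0<..} (s k)" for k
      unfolding s_def by (intro continuous_intros psi_cont outer_cutoff_continuous R)
    show "\<bar>s k x\<bar> \<le> C" if "0 < x" for k x
      using mult_mono[OF B(1)[OF that] oc[of k x]] C by (simp add: s_def abs_mult)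
    have "(\<lambda>k. \<psi> x * outer_cutoff (R k) x) \<longlonglongrightarrow> \<psi> x * 1" for x
      unfolding R_def by (intro tendsto_intros outer_cutoff_limits)
    then show "(\<lambda>k. s k x) \<longlonglongrightarrow> \<psi> x" for x by (simp add: s_def)
  qed (rule psi_cont)
  then have lim1: "(\<lambda>k. \<kappa>\<^sup>2 * (\<integral>x. indicator {0<..} x * s k x \<partial>\<nu>)) \<longlonglongrightarrow>
      \<kappa>\<^sup>2 * (\<integral>x. indicator {0<..} x * \<psi> x \<partial>\<nu>)"
    by (intro tendsto_intros)
  have lim2: "(\<lambda>k. \<integral>x. indicator {0<..} x * s'' k x \<partial>\<nu>) \<longlonglongrightarrow> (\<integral>x. indicator {0<..} x * \<psi>'' x \<partial>\<nu>)"
  proof (rule half_line_dominated_convergence[OF fin sets])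
    show "continuous_on {0<..} (s'' k)" for k
      unfolding s''_def by (intro continuous_intros psi_cont cont outer_cutoff_continuous R)
    \<comment> \<open>The numbers 1, 6 and 30 bound the outer cutoff and its first two
      derivatives.\<close>
    show "\<bar>s'' k x\<bar> \<le> C * 1 + 2 * (C * 6) + C * 30" if "0 < x" for k x
    proof -
      have "\<bar>s'' k x\<bar> \<le> \<bar>\<psi>'' x\<bar> * \<bar>outer_cutoff (R k) x\<bar> + 2 * (\<bar>\<psi>' x\<bar> * \<bar>outer_cutoff' (R k) x\<bar>)
          + \<bar>\<psi> x\<bar> * \<bar>outer_cutoff'' (R k) x\<bar>"
        unfolding s''_def by (intro order_trans[OF abs_triangle_ineq] add_mono) (auto simp: abs_mult)
      also have "\<dots> \<le> C * 1 + 2 * (C * 6) + C * 30"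
        using B that C oc oc' by (intro add_mono mult_left_mono mult_mono) auto
      finally show ?thesis .
    qed
    have "(\<lambda>k. \<psi>'' x * outer_cutoff (R k) x + 2 * \<psi>' x * outer_cutoff' (R k) x
      + \<psi> x * outer_cutoff'' (R k) x) \<longlonglongrightarrow> \<psi>'' x * 1 + 2 * \<psi>' x * 0 + \<psi> x * 0" for x
      unfolding R_def by (intro tendsto_intros outer_cutoff_limits)
    then show "(\<lambda>k. s'' k x) \<longlonglongrightarrow> \<psi>'' x" for x by (simp add: s''_def)
  qed (rule cont)
  show ?thesis
    using LIMSEQ_unique[OF lim1[unfolded step] lim2] .
qed

text \<open>Variation of constants, started at 0. The forcing is damped by exp (- \<kappa> (x - y)),
  whose integral over y from 0 to x is at most 1 / \<kappa>; hence the bound.\<close>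

lemma linear_ode_solution:
  fixes G G' :: "real \<Rightarrow> real"
  assumes \<kappa>: "0 < \<kappa>" and e: "0 < e" and cont: "continuous_on {0<..} G"
    and zero: "\<And>x. x \<le> e \<Longrightarrow> G x = 0" and B: "\<And>x. 0 < x \<Longrightarrow> \<bar>G x\<bar> \<le> C"
  obtains \<psi> where "\<And>x. x \<le> e \<Longrightarrow> \<psi> x = 0"
    and "\<And>x. 0 < x \<Longrightarrow> (\<psi> has_real_derivative G x - \<kappa> * \<psi> x) (at x)"
    and "\<And>x. 0 < x \<Longrightarrow> \<bar>\<psi> x\<bar> \<le> C / \<kappa>"
proof -
  have contU: "continuous_on UNIV G"
  proof -
    have "continuous_on {..<e} G"
      by (rule continuous_on_eq[of _ "\<lambda>_. 0"]) (auto simp: zero)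
    then have "continuous_on ({0<..} \<union> {..<e}) G"
      by (intro continuous_on_open_Un cont) auto
    moreover have "{0<..} \<union> {..<e} = UNIV" using e by auto
    ultimately show ?thesis by simp
  qed
  define H where "H y = exp (\<kappa> * y) * G y" for y
  have H_cont: "continuous_on S H" for S
    unfolding H_def by (intro continuous_intros continuous_on_subset[OF contU]) auto
  \<comment> \<open>For negative \<open>x\<close> the interval is empty, so the solution is 0 there
    as required.\<close>
  define F where "F x = integral {0..x} H" for x
  define \<psi> where "\<psi> x = exp (- \<kappa> * x) * F x" for x
  have C: "0 \<le> C" using B[of 1] by simp
  have "F x = 0" if "x \<le> e" for x
  proof -
    have "F x = integral {0..x} (\<lambda>_. 0)"
      unfolding F_def by (intro integral_cong) (use that in \<open>auto simp: H_def zero\<close>)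
    then show ?thesis by simp
  qed
  moreover have "(F has_real_derivative H x) (at x)" if x: "0 < x" for x
  proof -
    have "((\<lambda>u. integral {0..u} H) has_real_derivative H x) (at x within {0..x + 1})"
      using x by (intro integral_has_real_derivative H_cont) auto
    then show ?thesis
      unfolding F_def using x by (simp add: at_within_Icc_at)
  qed
  then have "(\<psi> has_real_derivative G x - \<kappa> * \<psi> x) (at x)" if "0 < x" for x
  proof -
    have "(\<psi> has_real_derivative (exp (- \<kappa> * x) * - \<kappa>) * F x + H x * exp (- \<kappa> * x)) (at x)"
      unfolding \<psi>_def
      by (intro DERIV_mult \<open>\<And>x. 0 < x \<Longrightarrow> (F has_real_derivative H x) (at x)\<close> that)
        (auto intro!: derivative_eq_intros)
    then show ?thesis
      by (rule DERIV_cong) (simp add: \<psi>_def H_def exp_minus)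
  qed
  moreover have "\<bar>\<psi> x\<bar> \<le> C / \<kappa>" if x: "0 < x" for x
  proof -
    have hi: "((\<lambda>y. C * exp (\<kappa> * y)) has_integral (C / \<kappa> * exp (\<kappa> * x) - C / \<kappa> * exp (\<kappa> * 0))) {0..x}"
      using x \<kappa> by (intro fundamental_theorem_of_calculus)
        (auto intro!: derivative_eq_intros simp flip: has_real_derivative_iff_has_vector_derivative)
    have "norm (F x) \<le> integral {0..x} (\<lambda>y. C * exp (\<kappa> * y))"
      unfolding F_def
    proof (rule integral_norm_bound_integral)
      show "norm (H y) \<le> C * exp (\<kappa> * y)" if "y \<in> {0..x}" for y
        using B[of y] zero[of y] e C by (cases "y \<le> 0") (auto simp: H_def abs_mult)
    qed (use hi integrable_continuous_real[OF H_cont] in \<open>auto simp: has_integral_iff\<close>)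
    also have "\<dots> = C / \<kappa> * exp (\<kappa> * x) - C / \<kappa>"
      using hi by (simp add: has_integral_iff)
    also have "\<dots> \<le> C / \<kappa> * exp (\<kappa> * x)"
      using C \<kappa> by simp
    finally have "exp (- \<kappa> * x) * \<bar>F x\<bar> \<le> exp (- \<kappa> * x) * (C / \<kappa> * exp (\<kappa> * x))"
      by (intro mult_left_mono) auto
    also have "\<dots> = C / \<kappa>"
      by (simp add: mult.left_commute[of "exp _"] flip: exp_add)
    finally show ?thesis
      by (simp add: \<psi>_def abs_mult)
  qed
  ultimately show ?thesis
    by (intro that[of \<psi>]) (auto simp: \<psi>_def)
qed

text \<open>The mean value theorem on [y, x] with y tending to 0, so that \<open>f0\<close> is a
  limit and not a value of \<open>f\<close>.\<close>

lemma abs_diff_limit_le: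
  fixes f :: "real \<Rightarrow> real"
  assumes d: "\<And>x. 0 < x \<Longrightarrow> (f has_real_derivative f' x) (at x)"
    and B: "\<And>x. 0 < x \<Longrightarrow> \<bar>f' x\<bar> \<le> C"
    and lim: "(f \<longlongrightarrow> f0) (at_right 0)" and x: "0 < x"
  shows "\<bar>f x - f0\<bar> \<le> C * x"
proof (rule tendsto_upperbound)
  show "((\<lambda>y. \<bar>f x - f y\<bar>) \<longlongrightarrow> \<bar>f x - f0\<bar>) (at_right 0)"
    by (intro tendsto_intros lim)
  have C: "0 \<le> C" using B[of 1] by simp
  have "\<bar>f x - f y\<bar> \<le> C * x" if y: "0 < y" "y < x" for y
  proof -
    obtain z where "y < z" "z < x" "f x - f y = (x - y) * f' z"
      using MVT2[of y x f f'] d y by force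
    then have "\<bar>f x - f y\<bar> \<le> x * C"
      using B[of z] y C by (simp add: abs_mult) (intro mult_mono, auto)
    then show ?thesis by (simp add: mult.commute)
  qed
  then show "\<forall>\<^sub>F y in at_right 0. \<bar>f x - f y\<bar> \<le> C * x"
    using x eventually_at_right_less by (auto simp: eventually_at_right intro!: exI[of _ x])
qed simp

text \<open>If \<open>\<psi>' + \<kappa> \<psi> = g\<close>, then \<open>\<psi>'' - \<kappa>\<^sup>2 \<psi> = g' - \<kappa> g\<close>. This is applied to \<open>f - f0\<close> times a cutoff near 0;
  since \<open>f - f0\<close> is \<open>O(x)\<close>, the derivative of the cutoff, of order \<open>1 / x\<close>, disappears in the limit.\<close>

lemma half_line_exponential:
  fixes \<nu> :: "real measure" and \<kappa> :: real
  assumes fin: "finite_measure \<nu>" and sets: "sets \<nu> = sets borel" and \<kappa>: "0 < \<kappa>"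
    and eq: "\<And>\<phi> e. test_function \<phi> \<Longrightarrow> 0 < e \<Longrightarrow> (\<And>x. x \<le> e \<Longrightarrow> \<phi> x = 0) \<Longrightarrow>
      \<kappa>\<^sup>2 * (\<integral>x. \<phi> x \<partial>\<nu>) = (\<integral>x. deriv (deriv \<phi>) x \<partial>\<nu>)"
    and d: "\<And>x. 0 < x \<Longrightarrow> (f has_real_derivative f' x) (at x)"
    and cont: "continuous_on {0<..} f'"
    and B: "\<And>x. 0 < x \<Longrightarrow> \<bar>f x\<bar> \<le> C" "\<And>x. 0 < x \<Longrightarrow> \<bar>f' x\<bar> \<le> C"
    and lim: "(f \<longlongrightarrow> f0) (at_right 0)"
  shows "(\<integral>x. indicator {0<..} x * f' x \<partial>\<nu>) =
    \<kappa> * (\<integral>x. indicator {0<..} x * (f x - f0) \<partial>\<nu>)"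
proof -
  have f_cont: "continuous_on {0<..} f"
    using d by (auto intro!: continuous_at_imp_continuous_on DERIV_isCont)
  have C: "0 \<le> C" using B(1)[of 1] by simp
  have lin: "\<bar>f x - f0\<bar> \<le> C * x" if "0 < x" for x
    using abs_diff_limit_le[OF d B(2) lim that] .
  define K where "K = C + \<bar>f0\<bar>"
  have K: "0 \<le> K" using C by (simp add: K_def)
  have diff: "\<bar>f x - f0\<bar> \<le> K" if "0 < x" for x
    using B(1)[OF that] by (simp add: K_def)
  define c where "c k = inverse (real (Suc k))" for k
  have c: "0 < c k" for k by (simp add: c_def)
  define G where "G k x = (f x - f0) * inner_cutoff (c k) x" for k x
  define G' where "G' k x = f' x * inner_cutoff (c k) x + (f x - f0) * inner_cutoff' (c k) x" for k x
  have G_cont: "continuous_on {0<..} (G k)" "continuous_on {0<..} (G' k)" for k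
    unfolding G_def G'_def by (intro continuous_intros f_cont cont inner_cutoff_continuous)+
  have ic: "\<bar>inner_cutoff (c k) x\<bar> \<le> 1" for k x
    using inner_cutoff_bounds[of "c k" x] c[of k] by simp
  have G_bound: "\<bar>G k x\<bar> \<le> K" if "0 < x" for k x
    using mult_mono[OF diff[OF that] ic[of k x]] K by (simp add: G_def abs_mult)
  \<comment> \<open>The constant is C + 3 C: in the second term |f x - f0| <= C x meets the bound 3
    for x times the derivative of the cutoff.\<close>
  have G'_bound: "\<bar>G' k x\<bar> \<le> 4 * C" if x: "0 < x" for k x
  proof -
    have "\<bar>f' x * inner_cutoff (c k) x\<bar> \<le> C * 1"
      unfolding abs_mult using B(2)[OF x] ic C by (intro mult_mono) auto
    moreover have "\<bar>(f x - f0) * inner_cutoff' (c k) x\<bar> \<le> C * 3"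
    proof -
      have "\<bar>(f x - f0) * inner_cutoff' (c k) x\<bar> \<le> C * x * \<bar>inner_cutoff' (c k) x\<bar>"
        unfolding abs_mult using lin[OF x] by (intro mult_right_mono) auto
      also have "\<dots> = C * \<bar>x * inner_cutoff' (c k) x\<bar>"
        using x by (simp add: abs_mult)
      also have "\<dots> \<le> C * 3"
        using inner_cutoff'_bound[of "c k" x] c[of k] x C by (intro mult_left_mono) auto
      finally show ?thesis .
    qed
    ultimately show ?thesis unfolding G'_def by linarith
  qed
  have step: "(\<integral>x. indicator {0<..} x * G' k x \<partial>\<nu>) = \<kappa> * (\<integral>x. indicator {0<..} x * G k x \<partial>\<nu>)" for k
  proof -
    have G_zero: "G k x = 0" if "x \<le> c k" for x
      using inner_cutoff_eq_0[OF c that] by (simp add: G_def)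
    obtain \<psi> where \<psi>_zero: "\<And>x. x \<le> c k \<Longrightarrow> \<psi> x = 0"
      and \<psi>_d: "\<And>x. 0 < x \<Longrightarrow> (\<psi> has_real_derivative G k x - \<kappa> * \<psi> x) (at x)"
      and \<psi>_b: "\<And>x. 0 < x \<Longrightarrow> \<bar>\<psi> x\<bar> \<le> K / \<kappa>"
      using linear_ode_solution[OF \<kappa> c[of k] G_cont(1)[of k] G_zero G_bound[of _ k]] by blast
    have \<psi>_cont: "continuous_on {0<..} \<psi>"
      using \<psi>_d by (auto intro!: continuous_at_imp_continuous_on DERIV_isCont)
    define \<psi>' where "\<psi>' x = G k x - \<kappa> * \<psi> x" for x
    define \<psi>'' where "\<psi>'' x = G' k x - \<kappa> * \<psi>' x" for x
    have \<psi>'_cont: "continuous_on {0<..} \<psi>'"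
      unfolding \<psi>'_def by (intro continuous_intros G_cont \<psi>_cont)
    have G_d: "(G k has_real_derivative G' k x) (at x)" if "0 < x" for x
      unfolding G_def G'_def
      by (rule DERIV_cong[OF DERIV_mult[OF DERIV_diff[OF d[OF that] DERIV_const]
            DERIV_inner_cutoff(1)[OF that]]]) simp
    \<comment> \<open>A sum of three nonnegative bounds, which dominates each of them.\<close>
    define E where "E = K / \<kappa> + (K + \<kappa> * (K / \<kappa>)) + (4 * C + \<kappa> * (K + \<kappa> * (K / \<kappa>)))"
    have \<psi>'_b: "\<bar>\<psi>' x\<bar> \<le> K + \<kappa> * (K / \<kappa>)" if "0 < x" for x
      unfolding \<psi>'_def using G_bound[OF that, of k] mult_left_mono[OF \<psi>_b[OF that], of \<kappa>] \<kappa>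
      by (intro order_trans[OF abs_triangle_ineq4] add_mono) (auto simp: abs_mult)
    have \<psi>''_b: "\<bar>\<psi>'' x\<bar> \<le> 4 * C + \<kappa> * (K + \<kappa> * (K / \<kappa>))" if "0 < x" for x
      unfolding \<psi>''_def using G'_bound[OF that, of k] mult_left_mono[OF \<psi>'_b[OF that], of \<kappa>] \<kappa>
      by (intro order_trans[OF abs_triangle_ineq4] add_mono) (auto simp: abs_mult)
    have nonneg: "0 \<le> K / \<kappa>" "0 \<le> K + \<kappa> * (K / \<kappa>)" "0 \<le> 4 * C + \<kappa> * (K + \<kappa> * (K / \<kappa>))"
      using K C \<kappa> by auto
    have "\<kappa>\<^sup>2 * (\<integral>x. indicator {0<..} x * \<psi> x \<partial>\<nu>) = (\<integral>x. indicator {0<..} x * \<psi>'' x \<partial>\<nu>)"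
    proof (rule half_line_resolvent[OF fin sets eq c[of k], where \<psi> = \<psi> and \<psi>' = \<psi>' and \<psi>'' = \<psi>'' and C = E])
      show "(\<psi> has_real_derivative \<psi>' x) (at x)" if "0 < x" for x
        using \<psi>_d[OF that] by (simp add: \<psi>'_def)
      show "(\<psi>' has_real_derivative \<psi>'' x) (at x)" if "0 < x" for x
        unfolding \<psi>''_def using DERIV_diff[OF G_d[OF that] DERIV_cmult[OF \<psi>_d[OF that], of \<kappa>]]
        by (simp add: \<psi>'_def[abs_def])
      show "continuous_on {0<..} \<psi>''"
        unfolding \<psi>''_def by (intro continuous_intros G_cont \<psi>'_cont)
      show "\<bar>\<psi> x\<bar> \<le> E" "\<bar>\<psi>' x\<bar> \<le> E" "\<bar>\<psi>'' x\<bar> \<le> E" if "0 < x" for x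
        using \<psi>_b[OF that] \<psi>'_b[OF that] \<psi>''_b[OF that] nonneg unfolding E_def by linarith+
    qed (use \<psi>_zero in auto)
    \<comment> \<open>The differential equation gives \<psi>'' = G' - \<kappa> G + \<kappa>^2
      \<psi>, and the integrals of \<kappa>^2 \<psi> on the two sides cancel.\<close>
    also have "\<dots> = (\<integral>x. indicator {0<..} x * G' k x - \<kappa> * (indicator {0<..} x * G k x)
        + \<kappa>\<^sup>2 * (indicator {0<..} x * \<psi> x) \<partial>\<nu>)"
      by (intro Bochner_Integration.integral_cong)
        (auto simp: \<psi>''_def \<psi>'_def power2_eq_square algebra_simps)
    also have "\<dots> = (\<integral>x. indicator {0<..} x * G' k x \<partial>\<nu>) - \<kappa> * (\<integral>x. indicator {0<..} x * G k x \<partial>\<nu>)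
        + \<kappa>\<^sup>2 * (\<integral>x. indicator {0<..} x * \<psi> x \<partial>\<nu>)"
      using half_line_integrable[OF fin sets G_cont(2) G'_bound]
        half_line_integrable[OF fin sets G_cont(1) G_bound]
        half_line_integrable[OF fin sets \<psi>_cont \<psi>_b]
      by simp
    finally show ?thesis by simp
  qed
  have "(\<lambda>k. \<integral>x. indicator {0<..} x * G' k x \<partial>\<nu>) \<longlonglongrightarrow> (\<integral>x. indicator {0<..} x * f' x \<partial>\<nu>)"
  proof (rule half_line_dominated_convergence[OF fin sets G_cont(2) cont G'_bound])
    fix x :: real assume "0 < x"
    then have "(\<lambda>k. G' k x) \<longlonglongrightarrow> f' x * 1 + (f x - f0) * 0"
      unfolding G'_def c_def by (intro tendsto_intros inner_cutoff_limits)
    then show "(\<lambda>k. G' k x) \<longlonglongrightarrow> f' x" by simp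
  qed
  moreover have "(\<lambda>k. \<integral>x. indicator {0<..} x * G k x \<partial>\<nu>) \<longlonglongrightarrow> (\<integral>x. indicator {0<..} x * (f x - f0) \<partial>\<nu>)"
  proof (rule half_line_dominated_convergence[OF fin sets G_cont(1) _ G_bound])
    show "continuous_on {0<..} (\<lambda>x. f x - f0)" by (intro continuous_intros f_cont)
    fix x :: real assume "0 < x"
    then have "(\<lambda>k. G k x) \<longlonglongrightarrow> (f x - f0) * 1"
      unfolding G_def c_def by (intro tendsto_intros inner_cutoff_limits)
    then show "(\<lambda>k. G k x) \<longlonglongrightarrow> f x - f0" by simp
  qed
  then have "(\<lambda>k. \<kappa> * (\<integral>x. indicator {0<..} x * G k x \<partial>\<nu>)) \<longlonglongrightarrow>
      \<kappa> * (\<integral>x. indicator {0<..} x * (f x - f0) \<partial>\<nu>)"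
    by (intro tendsto_intros)
  ultimately show ?thesis
    unfolding step by (rule LIMSEQ_unique)
qed

text \<open>No mass escapes to 0 or to infinity, because the limit is again a probability measure on the open
  half line.\<close>

lemma half_line_vague_imp_continuous:
  fixes \<mu> :: "real \<Rightarrow> real measure"
  assumes prob: "\<And>t. 0 < t \<Longrightarrow> prob_space (\<mu> t)" and sets: "\<And>t. 0 < t \<Longrightarrow> sets (\<mu> t) = sets borel"
    and pos: "\<And>t. 0 < t \<Longrightarrow> AE x in \<mu> t. 0 < x"
    and vague: "\<And>\<phi> e. test_function \<phi> \<Longrightarrow> 0 < e \<Longrightarrow> (\<And>x. x \<le> e \<Longrightarrow> \<phi> x = 0) \<Longrightarrow>
      continuous_on {0<..} (\<lambda>t. \<integral>x. \<phi> x \<partial>\<mu> t)"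
    and d: "\<And>x. 0 < x \<Longrightarrow> (f has_real_derivative f' x) (at x)"
    and d': "\<And>x. 0 < x \<Longrightarrow> (f' has_real_derivative f'' x) (at x)"
    and cont: "continuous_on {0<..} f''"
    and B: "\<And>x. 0 < x \<Longrightarrow> \<bar>f x\<bar> \<le> C"
  shows "continuous_on {0<..} (\<lambda>t. \<integral>x. indicator {0<..} x * f x \<partial>\<mu> t)"
proof -
  define c where "c k = inverse (real (Suc k))" for k
  have c: "0 < c k" for k by (simp add: c_def)
  have C: "0 \<le> C" using B[of 1] by simp
  define \<theta> where "\<theta> k x = inner_cutoff (c k) x * outer_cutoff (real (Suc k)) x" for k x
  have \<theta>: "0 \<le> \<theta> k x" "\<theta> k x \<le> 1" for k x
    using inner_cutoff_bounds[of "c k" x] outer_cutoff_bounds[of "real (Suc k)" x] c[of k]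
    by (auto simp: \<theta>_def intro!: mult_le_one)
  have \<theta>_cont: "continuous_on {0<..} (\<theta> k)" for k
    unfolding \<theta>_def by (intro continuous_intros inner_cutoff_continuous outer_cutoff_continuous) auto
  \<comment> \<open>Applied to \<open>f\<close> and to the constant 1; the latter measures the mass
    that the cutoff retains.\<close>
  have cutoff: "continuous_on {0<..} (\<lambda>t. \<integral>x. indicator {0<..} x * (g x * \<theta> k x) \<partial>\<mu> t)"
    if gd: "\<And>x. 0 < x \<Longrightarrow> (g has_real_derivative g' x) (at x)"
    and gd': "\<And>x. 0 < x \<Longrightarrow> (g' has_real_derivative g'' x) (at x)"
    and g'': "continuous_on {0<..} g''" for g g' g'' k
  proof -
    let ?w = "inner_cutoff (c k)" and ?w' = "inner_cutoff' (c k)" and ?w'' = "inner_cutoff'' (c k)"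
    have zero: "g x * ?w x = 0" if "x \<le> c k" for x
      using inner_cutoff_eq_0[OF c that] by simp
    have "test_function (\<lambda>x. (g x * ?w x) * outer_cutoff (real (Suc k)) x)"
    proof (rule test_function_cutoff(1)[OF _ c[of k]])
      show "((\<lambda>x. g x * ?w x) has_real_derivative g' x * ?w x + g x * ?w' x) (at x)" if "0 < x" for x
        by (rule DERIV_cong[OF DERIV_mult[OF gd[OF that] DERIV_inner_cutoff(1)[OF that]]]) simp
      show "((\<lambda>x. g' x * ?w x + g x * ?w' x) has_real_derivative
          (g'' x * ?w x + g' x * ?w' x) + (g' x * ?w' x + g x * ?w'' x)) (at x)" if "0 < x" for x
        by (rule DERIV_cong[OF DERIV_add[OF DERIV_mult[OF gd'[OF that] DERIV_inner_cutoff(1)[OF that]]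
            DERIV_mult[OF gd[OF that] DERIV_inner_cutoff(2)[OF that]]]]) simp
      have "continuous_on {0<..} g" "continuous_on {0<..} g'"
        using gd gd' by (auto intro!: continuous_at_imp_continuous_on DERIV_isCont)
      moreover have "continuous_on {0<..} ?w''"
        unfolding inner_cutoff''_def by (auto intro!: continuous_intros)
      ultimately show "continuous_on {0<..} (\<lambda>x. (g'' x * ?w x + g' x * ?w' x) + (g' x * ?w' x + g x * ?w'' x))"
        by (intro continuous_intros inner_cutoff_continuous g'')
    qed (use zero in auto)
    from vague[OF this c[of k]] zero
    have "continuous_on {0<..} (\<lambda>t. \<integral>x. (g x * ?w x) * outer_cutoff (real (Suc k)) x \<partial>\<mu> t)"
      by auto
    also have "(\<lambda>x. (g x * ?w x) * outer_cutoff (real (Suc k)) x) = (\<lambda>x. indicator {0<..} x * (g x * \<theta> k x))"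
      using c[of k] by (auto simp: \<theta>_def fun_eq_iff indicator_def inner_cutoff_def)
    finally show ?thesis .
  qed
  define F where "F t = (\<integral>x. indicator {0<..} x * f x \<partial>\<mu> t)" for t
  define Fk where "Fk k t = (\<integral>x. indicator {0<..} x * (f x * \<theta> k x) \<partial>\<mu> t)" for k t
  define gk where "gk k t = (\<integral>x. indicator {0<..} x * (1 * \<theta> k x) \<partial>\<mu> t)" for k t
  have Fk_cont: "continuous_on {0<..} (Fk k)" for k
    unfolding Fk_def by (rule cutoff[OF d d' cont])
  have gk_cont: "continuous_on {0<..} (gk k)" for k
    unfolding gk_def by (rule cutoff[of "\<lambda>_. 1" "\<lambda>_. 0" "\<lambda>_. 0"]) auto
  have f_cont: "continuous_on {0<..} f"
    using d by (auto intro!: continuous_at_imp_continuous_on DERIV_isCont)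
  \<comment> \<open>The truncation error is at most \<open>C\<close> times the mass that the cutoff
    misses.\<close>
  have diff: "\<bar>F t - Fk k t\<bar> \<le> C * (1 - gk k t)" if t: "0 < t" for k t
  proof -
    interpret prob_space "\<mu> t" using prob[OF t] .
    have fin: "finite_measure (\<mu> t)" by unfold_locales
    have b\<theta>: "\<bar>f x * \<theta> k x\<bar> \<le> C" if "0 < x" for x
      using mult_mono[OF B[OF that] \<theta>(2)[of k x]] \<theta>[of k x] C by (simp add: abs_mult)
    have c\<theta>: "continuous_on {0<..} (\<lambda>x. f x * \<theta> k x)" by (intro continuous_intros f_cont \<theta>_cont)
    have b1: "\<bar>1 * \<theta> k x\<bar> \<le> 1" for x using \<theta>[of k x] by simp
    note int = half_line_integrable[OF fin sets[OF t] f_cont B] half_line_integrable[OF fin sets[OF t] c\<theta> b\<theta>]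
    have int1: "integrable (\<mu> t) (\<lambda>x. indicator {0<..} x * (1 * \<theta> k x))"
      by (rule half_line_integrable[OF fin sets[OF t] _ b1]) (use \<theta>_cont in auto)
    have "\<bar>F t - Fk k t\<bar> = \<bar>\<integral>x. indicator {0<..} x * f x - indicator {0<..} x * (f x * \<theta> k x) \<partial>\<mu> t\<bar>"
      using int by (simp add: F_def Fk_def)
    also have "\<dots> \<le> (\<integral>x. \<bar>indicator {0<..} x * f x - indicator {0<..} x * (f x * \<theta> k x)\<bar> \<partial>\<mu> t)"
      by (rule integral_abs_bound)
    also have "\<dots> \<le> (\<integral>x. C * (1 - indicator {0<..} x * (1 * \<theta> k x)) \<partial>\<mu> t)"
    proof (rule integral_mono)
      show "\<bar>indicator {0<..} x * f x - indicator {0<..} x * (f x * \<theta> k x)\<bar> \<le>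
          C * (1 - indicator {0<..} x * (1 * \<theta> k x))" for x
      proof (cases "0 < x")
        case True
        have "\<bar>f x - f x * \<theta> k x\<bar> = \<bar>f x\<bar> * (1 - \<theta> k x)"
          using \<theta>[of k x] by (simp add: abs_mult flip: right_diff_distrib[of "f x" 1, simplified])
        also have "\<dots> \<le> C * (1 - \<theta> k x)" using B[OF True] \<theta>[of k x] by (intro mult_right_mono) auto
        finally show ?thesis using True by simp
      qed (use C in auto)
    qed (use int int1 in auto)
    also have "\<dots> = C * (1 - gk k t)"
      using int1 by (simp add: gk_def prob_space)
    finally show ?thesis .
  qed
  show ?thesis
    unfolding F_def[symmetric] continuous_on_def
  proof safe
    fix t0 :: real assume t0: "0 < t0"
    have "(F \<longlongrightarrow> F t0) (at t0)"
    proof (rule tendstoI)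
      fix \<epsilon> :: real assume \<epsilon>: "0 < \<epsilon>"
      interpret prob_space "\<mu> t0" using prob[OF t0] .
      have fin: "finite_measure (\<mu> t0)" by unfold_locales
      have "(\<lambda>k. gk k t0) \<longlonglongrightarrow> (\<integral>x. indicator {0<..} x * 1 \<partial>\<mu> t0)"
        unfolding gk_def
      proof (rule half_line_dominated_convergence[OF fin sets[OF t0]])
        show "\<bar>1 * \<theta> k x\<bar> \<le> 1" for k x using \<theta>[of k x] by simp
        fix x :: real assume "0 < x"
        then have "(\<lambda>k. \<theta> k x) \<longlonglongrightarrow> 1 * 1"
          unfolding \<theta>_def c_def by (intro tendsto_intros inner_cutoff_limits outer_cutoff_limits)
        then show "(\<lambda>k. 1 * \<theta> k x) \<longlonglongrightarrow> 1" by simp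
      qed (use \<theta>_cont in auto)
      also have "(\<integral>x. indicator {0<..} x * 1 \<partial>\<mu> t0) = (\<integral>x. 1 \<partial>\<mu> t0 :: real)"
        using pos[OF t0] half_line_measurable[OF sets[OF t0], of "\<lambda>_. 1"]
        by (intro integral_cong_AE) auto
      also have "\<dots> = 1" by (simp add: prob_space)
      \<comment> \<open>The factor 2 provides for the truncation errors at \<open>t0\<close> and at
        a nearby time; at the latter the missed mass is controlled through the continuity of
        \<open>gk k\<close>.\<close>
      finally have "(\<lambda>k. 2 * C * (1 - gk k t0)) \<longlonglongrightarrow> 2 * C * (1 - 1)"
        by (intro tendsto_intros)
      then have "\<forall>\<^sub>F k in sequentially. 2 * C * (1 - gk k t0) < \<epsilon>"
        using \<epsilon> by (intro order_tendstoD(2)) auto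
      then obtain k where k: "2 * C * (1 - gk k t0) < \<epsilon>"
        by (auto simp: eventually_sequentially)
      have "(Fk k \<longlongrightarrow> Fk k t0) (at t0)" "(gk k \<longlongrightarrow> gk k t0) (at t0)"
        using Fk_cont[of k] gk_cont[of k] t0 by (auto simp: continuous_on_eq_continuous_at isCont_def)
      then have "((\<lambda>t. \<bar>Fk k t - Fk k t0\<bar> + C * (1 - gk k t) + C * (1 - gk k t0)) \<longlongrightarrow>
          \<bar>Fk k t0 - Fk k t0\<bar> + C * (1 - gk k t0) + C * (1 - gk k t0)) (at t0)"
        by (intro tendsto_intros)
      then have "\<forall>\<^sub>F t in at t0. \<bar>Fk k t - Fk k t0\<bar> + C * (1 - gk k t) + C * (1 - gk k t0) < \<epsilon>"
        by (rule order_tendstoD(2)) (use k in simp)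
      moreover have "\<forall>\<^sub>F t in at t0. t \<in> {0<..}"
        using t0 by (intro eventually_at_in_open') auto
      ultimately show "\<forall>\<^sub>F t in at t0. dist (F t) (F t0) < \<epsilon>"
      proof eventually_elim
        case (elim t)
        then show ?case
          using diff[of t k] diff[OF t0, of k] by (simp add: dist_real_def)
      qed
    qed
    then show "(F \<longlongrightarrow> F t0) (at t0 within {0<..})"
      by (rule tendsto_within_subset) simp
  qed
qed

section \<open>The folded solution of the diffusion equation\<close>

text \<open>\<open>\<nu>\<close> is the marginal in x of the measure with density exp (- s t) w(x,
  t) for t > 0, which has total mass 1 / s. Fubini then exchanges the Laplace transform in t with
  integration in x.\<close>

lemma laplace_mixture:
  fixes w :: "real \<Rightarrow> real \<Rightarrow> real"
  assumes w [measurable]: "case_prod w \<in> borel_measurable (lborel \<Otimes>\<^sub>M lborel)"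
    and nonneg: "\<And>x t. 0 \<le> w x t"
    and prob: "\<And>t. 0 < t \<Longrightarrow> (\<integral>\<^sup>+x. ennreal (w x t) \<partial>lborel) = 1"
    and s: "0 < s"
  obtains \<nu> :: "real measure" where "finite_measure \<nu>" "sets \<nu> = sets borel"
    "\<And>h C. h \<in> borel_measurable borel \<Longrightarrow> (\<And>x. \<bar>h x\<bar> \<le> C) \<Longrightarrow>
      laplace_integrable (\<lambda>t. LBINT x. w x t * h x) s \<and>
      laplace (\<lambda>t. LBINT x. w x t * h x) s = (\<integral>x. h x \<partial>\<nu>)"
proof
  define W where "W = (\<lambda>(x, t). indicator {0<..} t * exp (- s * t) * w x t)"
  have W_meas [measurable]: "W \<in> borel_measurable (lborel \<Otimes>\<^sub>M lborel)"
    unfolding W_def by measurable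
  have W_nonneg: "0 \<le> W p" for p
    by (auto simp: W_def nonneg split: prod.split)
  define \<nu> where "\<nu> = distr (density (lborel \<Otimes>\<^sub>M lborel) (\<lambda>p. ennreal (W p))) borel fst"
  have nnW: "(\<integral>\<^sup>+p. ennreal (W p) \<partial>(lborel \<Otimes>\<^sub>M lborel)) = ennreal (1 / s)"
  proof -
    have "(\<integral>\<^sup>+p. ennreal (W p) \<partial>(lborel \<Otimes>\<^sub>M lborel)) = (\<integral>\<^sup>+t. \<integral>\<^sup>+x. ennreal (W (x, t)) \<partial>lborel \<partial>lborel)"
      by (rule lborel_pair.nn_integral_snd[symmetric]) measurable
    also have "\<dots> = (\<integral>\<^sup>+t. ennreal (indicator {0<..} t * exp (- s * t)) \<partial>lborel)"
    proof (rule nn_integral_cong)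
      fix t :: real
      have "(\<integral>\<^sup>+x. ennreal (W (x, t)) \<partial>lborel) =
          (\<integral>\<^sup>+x. ennreal (indicator {0<..} t * exp (- s * t)) * ennreal (w x t) \<partial>lborel)"
        by (intro nn_integral_cong) (simp add: W_def ennreal_mult' nonneg)
      also have "\<dots> = ennreal (indicator {0<..} t * exp (- s * t)) * (\<integral>\<^sup>+x. ennreal (w x t) \<partial>lborel)"
        by (rule nn_integral_cmult) measurable
      also have "\<dots> = ennreal (indicator {0<..} t * exp (- s * t))"
        by (cases "0 < t") (auto simp: prob)
      finally show "(\<integral>\<^sup>+x. ennreal (W (x, t)) \<partial>lborel) = ennreal (indicator {0<..} t * exp (- s * t))" .
    qed
    also have "\<dots> = ennreal (1 / s)"
    proof -
      have "integrable lborel (\<lambda>t. indicator {0<..} t * exp (- s * t))"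
        "(LBINT t. indicator {0<..} t * exp (- s * t)) = 1 / s"
        using laplace_const[OF s, of 1]
        by (simp_all add: laplace_integrable_def laplace_def set_integrable_def set_lebesgue_integral_def)
      then show ?thesis
        by (subst nn_integral_eq_integral) auto
    qed
    finally show ?thesis .
  qed
  have W_int: "integrable (lborel \<Otimes>\<^sub>M lborel) W"
    by (rule integrableI_nonneg) (auto simp: W_nonneg nnW)
  show "finite_measure \<nu>"
  proof
    let ?L = "lborel \<Otimes>\<^sub>M lborel :: (real \<times> real) measure"
    have "emeasure \<nu> (space \<nu>) = emeasure (density ?L (\<lambda>p. ennreal (W p))) (space ?L)"
      unfolding \<nu>_def by (subst emeasure_distr) auto
    also have "\<dots> = (\<integral>\<^sup>+p. ennreal (W p) * indicator (space ?L) p \<partial>?L)"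
      by (intro emeasure_density sets.top) measurable
    also have "\<dots> = (\<integral>\<^sup>+p. ennreal (W p) \<partial>?L)"
      by (intro nn_integral_cong) auto
    finally show "emeasure \<nu> (space \<nu>) \<noteq> \<infinity>"
      by (simp add: nnW)
  qed
  show "sets \<nu> = sets borel" by (simp add: \<nu>_def)
  fix h :: "real \<Rightarrow> real" and C :: real
  assume h [measurable]: "h \<in> borel_measurable borel" and C: "\<And>x. \<bar>h x\<bar> \<le> C"
  have "(\<integral>x. h x \<partial>\<nu>) = (\<integral>p. W p * h (fst p) \<partial>(lborel \<Otimes>\<^sub>M lborel))"
    unfolding \<nu>_def by (subst integral_distr) (auto simp: integral_density W_nonneg)
  also have "\<dots> = (\<integral>p. (\<lambda>(x, t). W (x, t) * h x) p \<partial>(lborel \<Otimes>\<^sub>M lborel))"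
    by (intro Bochner_Integration.integral_cong) auto
  finally have eq: "(\<integral>x. h x \<partial>\<nu>) = \<dots>" .
  have int: "integrable (lborel \<Otimes>\<^sub>M lborel) (\<lambda>(x, t). W (x, t) * h x)"
  proof (rule Bochner_Integration.integrable_bound)
    show "integrable (lborel \<Otimes>\<^sub>M lborel) (\<lambda>p. W p * C)" using W_int by simp
    show "AE p in lborel \<Otimes>\<^sub>M lborel. norm (case p of (x, t) \<Rightarrow> W (x, t) * h x) \<le> norm (W p * C)"
      using C by (intro AE_I2) (auto simp: abs_mult W_nonneg split: prod.split intro!: mult_left_mono
          order_trans[OF C abs_ge_self])
  qed measurable
  have inner: "(LBINT x. W (x, t) * h x) = indicator {0<..} t *\<^sub>R (exp (- s * t) * (LBINT x. w x t * h x))" for t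
    by (simp add: W_def mult.assoc)
  show "laplace_integrable (\<lambda>t. LBINT x. w x t * h x) s \<and>
      laplace (\<lambda>t. LBINT x. w x t * h x) s = (\<integral>x. h x \<partial>\<nu>)"
    using lborel_pair.integrable_snd[OF int] lborel_pair.integral_snd[OF int]
    unfolding eq laplace_integrable_def set_integrable_def laplace_def set_lebesgue_integral_def inner
    by auto
qed

section \<open>Test functions and measurability of the solution\<close>

lemma deriv_deriv_eq_0:
  assumes "open S" "x \<in> S" "\<And>y. y \<in> S \<Longrightarrow> \<phi> y = 0"
  shows "deriv (deriv \<phi>) x = (0 :: real)"
proof -
  have 1: "deriv \<phi> y = 0" if "y \<in> S" for y
  proof -
    have "((\<lambda>_. 0) has_real_derivative 0) (at y)" by simp
    then have "(\<phi> has_real_derivative 0) (at y)"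
      by (rule has_field_derivative_transform_within_open[OF _ assms(1) that]) (simp add: assms(3))
    then show ?thesis by (rule DERIV_imp_deriv)
  qed
  have "((\<lambda>_. 0) has_real_derivative 0) (at x)" by simp
  then have "(deriv \<phi> has_real_derivative 0) (at x)"
    by (rule has_field_derivative_transform_within_open[OF _ assms(1,2)]) (simp add: 1)
  then show ?thesis by (rule DERIV_imp_deriv)
qed

lemma continuous_compact_support_bounded:
  fixes g :: "real \<Rightarrow> real"
  assumes "continuous_on UNIV g" "\<And>x. R < \<bar>x\<bar> \<Longrightarrow> g x = 0"
  obtains C where "\<And>x. \<bar>g x\<bar> \<le> C"
proof -
  have "compact (g ` {-\<bar>R\<bar>..\<bar>R\<bar>})"
    by (intro compact_continuous_image continuous_on_subset[OF assms(1)]) auto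
  from compact_imp_bounded[OF this] obtain B where
    B: "\<And>x. x \<in> {-\<bar>R\<bar>..\<bar>R\<bar>} \<Longrightarrow> \<bar>g x\<bar> \<le> B"
    unfolding bounded_iff by fastforce
  have "0 \<le> B" using B[of 0] by simp
  then have "\<bar>g x\<bar> \<le> B" for x
    using B[of x] assms(2)[of x] by (cases "x \<in> {-\<bar>R\<bar>..\<bar>R\<bar>}") auto
  then show ?thesis by (rule that)
qed

lemma test_function_properties:
  assumes "test_function \<phi>"
  shows "continuous_on UNIV \<phi>" "continuous_on UNIV (deriv (deriv \<phi>))"
    and "\<exists>C. (\<forall>x. \<bar>\<phi> x\<bar> \<le> C) \<and> (\<forall>x. \<bar>deriv (deriv \<phi>) x\<bar> \<le> C)"
proof -
  show c: "continuous_on UNIV \<phi>" "continuous_on UNIV (deriv (deriv \<phi>))"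
    using assms
    by (auto simp: test_function_def intro!: continuous_at_imp_continuous_on
        differentiable_imp_continuous_within)
  obtain R where R: "\<And>x. R < \<bar>x\<bar> \<Longrightarrow> \<phi> x = 0"
    using assms by (auto simp: test_function_def)
  have "open {x::real. R < \<bar>x\<bar>}"
    by (intro open_Collect_less continuous_intros)
  then have R'': "deriv (deriv \<phi>) x = 0" if "R < \<bar>x\<bar>" for x
    using R that by (intro deriv_deriv_eq_0[of "{x. R < \<bar>x\<bar>}"]) auto
  obtain C1 C2 where "\<And>x. \<bar>\<phi> x\<bar> \<le> C1" "\<And>x. \<bar>deriv (deriv \<phi>) x\<bar> \<le> C2"
    using continuous_compact_support_bounded[OF c(1) R] continuous_compact_support_bounded[OF c(2) R'']
    by metis
  then show "\<exists>C. (\<forall>x. \<bar>\<phi> x\<bar> \<le> C) \<and> (\<forall>x. \<bar>deriv (deriv \<phi>) x\<bar> \<le> C)"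
    by (intro exI[of _ "max C1 C2"]) (auto intro: le_max_iff_disj[THEN iffD2])
qed

text \<open>Values of \<open>u\<close> at times t <= 0 are unconstrained; extension by 0 makes it
  measurable on the whole plane, as needed for Fubini.\<close>

lemma half_time_measurable:
  fixes u :: "real \<Rightarrow> real \<Rightarrow> real"
  assumes "(\<lambda>(x, t). u x t) \<in> borel_measurable (borel \<Otimes>\<^sub>M restrict_space borel {0<..})"
  shows "(\<lambda>(x, t). indicator {0<..} t * u x t) \<in> borel_measurable (lborel \<Otimes>\<^sub>M lborel)"
proof -
  let ?B = "borel \<Otimes>\<^sub>M borel :: (real \<times> real) measure"
  let ?S = "UNIV \<times> {0<..} :: (real \<times> real) set"
  have S: "?S \<in> sets ?B" by auto
  have 1: "fst \<in> measurable (restrict_space ?B ?S) borel"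
    by (rule measurable_restrict_space1) simp
  have 2: "snd \<in> measurable (restrict_space ?B ?S) (restrict_space borel {0<..})"
    by (rule measurable_restrict_space2)
      (auto simp: space_restrict_space intro: measurable_restrict_space1[OF measurable_snd])
  have "(\<lambda>p. u (fst p) (snd p)) \<in> borel_measurable (restrict_space ?B ?S)"
    using measurable_compose[OF measurable_Pair[OF 1 2] assms] by (simp add: split_beta)
  then have "(\<lambda>p. indicator ?S p *\<^sub>R u (fst p) (snd p)) \<in> borel_measurable ?B"
    using S by (subst (asm) borel_measurable_restrict_space_iff) auto
  also have "(\<lambda>p. indicator ?S p *\<^sub>R u (fst p) (snd p)) = (\<lambda>(x, t). indicator {0<..} t * u x t)"
    by (auto simp: fun_eq_iff indicator_def)
  finally show ?thesis
    by (simp add: measurable_cong_sets[OF sets_pair_measure_cong[OF sets_lborel sets_lborel] refl])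
qed

text \<open>The range is \<alpha> < 1, since the law has no density for \<alpha> = 1. The process
  enters through its laws \<open>\<mu> t\<close> at single times.\<close>

locale folded_diffusion =
  fixes \<alpha> :: real and u :: "real \<Rightarrow> real \<Rightarrow> real" and \<mu> :: "real \<Rightarrow> real measure"
  assumes \<alpha>: "0 < \<alpha>" "\<alpha> < 1"
    and solution: "frac_diffusion_solution (2 * \<alpha>) u"
    and u_nonneg: "\<And>t. 0 < t \<Longrightarrow> AE x in lborel. 0 < x \<longrightarrow> 0 \<le> u x t"
    and law: "\<And>t. 0 < t \<Longrightarrow> \<mu> t = density lborel (\<lambda>x. ennreal (indicator {0<..} x * (2 * u x t)))"
    and prob_law: "\<And>t. 0 < t \<Longrightarrow> prob_space (\<mu> t)"
begin

text \<open>A version of the folded density that is nonnegative everywhere. It gives exactly the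
  same measures, because \<open>ennreal\<close> already sends negative numbers to 0.\<close>

definition w :: "real \<Rightarrow> real \<Rightarrow> real" where
  "w x t = indicator {0<..} x * max 0 (2 * (indicator {0<..} t * u x t))"

lemma w_nonneg: "0 \<le> w x t"
  by (simp add: w_def)

lemma w_measurable: "case_prod w \<in> borel_measurable (lborel \<Otimes>\<^sub>M lborel)"
proof -
  have [measurable]: "(\<lambda>p. case p of (x, t) \<Rightarrow> indicator {0<..} t * u x t) \<in> borel_measurable (lborel \<Otimes>\<^sub>M lborel)"
    using solution half_time_measurable[of u] by (simp add: frac_diffusion_solution_def)
  have "case_prod w = (\<lambda>p. indicator {0<..} (fst p) * max 0 (2 * (case p of (x, t) \<Rightarrow> indicator {0<..} t * u x t)))"
    by (auto simp: w_def fun_eq_iff)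
  then show ?thesis by simp
qed

lemma w_measurable_space [measurable]: "(\<lambda>x. w x t) \<in> borel_measurable borel"
  using measurable_Pair1[OF w_measurable, of t] by simp

lemma law_eq: "0 < t \<Longrightarrow> \<mu> t = density lborel (\<lambda>x. ennreal (w x t))"
  unfolding law by (intro arg_cong[of _ _ "density lborel"]) (auto simp: w_def fun_eq_iff indicator_def max_def ennreal_neg)

lemma sets_law: "0 < t \<Longrightarrow> sets (\<mu> t) = sets borel"
  by (simp add: law)

lemma nn_integral_w: "0 < t \<Longrightarrow> (\<integral>\<^sup>+x. ennreal (w x t) \<partial>lborel) = 1"
  using prob_space.emeasure_space_1[OF prob_law, of t] by (simp add: law_eq emeasure_density)

lemma AE_law_pos:
  assumes "0 < t"
  shows "AE x in \<mu> t. 0 < x"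
proof -
  have m: "(\<lambda>x. ennreal (w x t)) \<in> borel_measurable lborel" by measurable
  show ?thesis
    unfolding law_eq[OF assms] AE_density[OF m] by (simp add: w_def indicator_def)
qed

lemma integral_law:
  "0 < t \<Longrightarrow> h \<in> borel_measurable borel \<Longrightarrow> (\<integral>x. h x \<partial>\<mu> t) = (LBINT x. w x t * h x)"
  by (subst law_eq) (simp_all add: integral_density w_nonneg)

text \<open>For x <= 0 the density \<open>w\<close> carries no information about \<open>u\<close>,
  so \<open>h\<close> has to vanish there; the factor 2 is that of the folding.\<close>

lemma integral_w_eq:
  assumes t: "0 < t" and [measurable]: "h \<in> borel_measurable borel" and "\<And>x. x \<le> 0 \<Longrightarrow> h x = 0"
  shows "(LBINT x. w x t * h x) = 2 * (LBINT x. u x t * h x)"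
proof -
  have [measurable]: "(\<lambda>x. u x t) \<in> borel_measurable borel"
    using solution t by (auto simp: frac_diffusion_solution_def dest: borel_measurable_integrable)
  have "(LBINT x. w x t * h x) = (LBINT x. 2 * (u x t * h x))"
  proof (rule integral_cong_AE)
    show "AE x in lborel. w x t * h x = 2 * (u x t * h x)"
      using u_nonneg[OF t]
    proof eventually_elim
      case (elim x)
      with t assms(3)[of x] show ?case by (cases "0 < x") (auto simp: w_def)
    qed
  qed measurable
  then show ?thesis by simp
qed

text \<open>As \<phi> vanishes near 0, its value at 0 contributes no initial mass, and its second
  derivative also lives on the positive half line. Hence \<open>u\<close> may be replaced by half of
  \<open>w\<close> on both sides.\<close>

lemma test_function_equation:
  assumes "test_function \<phi>" "0 < e" "\<And>x. x \<le> e \<Longrightarrow> \<phi> x = 0"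
  defines "m \<equiv> (\<lambda>t. LBINT x. u x t * \<phi> x)"
  shows "has_caputo_derivative (2 * \<alpha>) m" "(m \<longlongrightarrow> 0) (at_right 0)"
    "1 < 2 * \<alpha> \<Longrightarrow> (deriv m \<longlongrightarrow> 0) (at_right 0)"
    "\<And>t. 0 < t \<Longrightarrow> caputo_derivative (2 * \<alpha>) m t = 1 / 2 * (LBINT x. w x t * deriv (deriv \<phi>) x)"
    "\<And>t. 0 < t \<Longrightarrow> m t = 1 / 2 * (LBINT x. w x t * \<phi> x)"
proof -
  have \<phi>0: "\<phi> 0 = 0" using assms(2) assms(3)[of 0] by simp
  have all: "\<forall>\<phi>. test_function \<phi> \<longrightarrow> (let m = (\<lambda>t. LBINT x. u x t * \<phi> x) in
      has_caputo_derivative (2 * \<alpha>) m \<and>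
      (\<forall>t>0. caputo_derivative (2 * \<alpha>) m t = (LBINT x. u x t * deriv (deriv \<phi>) x)) \<and>
      (m \<longlongrightarrow> \<phi> 0) (at_right 0) \<and> (1 < 2 * \<alpha> \<longrightarrow> (deriv m \<longlongrightarrow> 0) (at_right 0)))"
    using solution unfolding frac_diffusion_solution_def by (elim conjE)
  have *: "has_caputo_derivative (2 * \<alpha>) m" "(m \<longlongrightarrow> 0) (at_right 0)"
    "1 < 2 * \<alpha> \<longrightarrow> (deriv m \<longlongrightarrow> 0) (at_right 0)"
    "\<forall>t>0. caputo_derivative (2 * \<alpha>) m t = (LBINT x. u x t * deriv (deriv \<phi>) x)"
    using all[rule_format, OF assms(1)] \<phi>0 by (simp_all add: m_def Let_def)
  from * show "has_caputo_derivative (2 * \<alpha>) m" "(m \<longlongrightarrow> 0) (at_right 0)"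
    "1 < 2 * \<alpha> \<Longrightarrow> (deriv m \<longlongrightarrow> 0) (at_right 0)" by auto
  fix t :: real assume t: "0 < t"
  have "deriv (deriv \<phi>) x = 0" if "x \<le> 0" for x
    using assms(2,3) that by (intro deriv_deriv_eq_0[of "{..<e}"]) auto
  moreover have "deriv (deriv \<phi>) \<in> borel_measurable borel" "\<phi> \<in> borel_measurable borel"
    using test_function_properties[OF assms(1)] by (auto intro: borel_measurable_continuous_onI)
  ultimately have "(LBINT x. w x t * deriv (deriv \<phi>) x) = 2 * (LBINT x. u x t * deriv (deriv \<phi>) x)"
    "(LBINT x. w x t * \<phi> x) = 2 * (LBINT x. u x t * \<phi> x)"
    using assms(2,3) by (intro integral_w_eq t; simp)+
  then show "caputo_derivative (2 * \<alpha>) m t = 1 / 2 * (LBINT x. w x t * deriv (deriv \<phi>) x)"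
    and "m t = 1 / 2 * (LBINT x. w x t * \<phi> x)"
    using *(4) t by (simp_all add: m_def)
qed

text \<open>Having a Caputo derivative includes differentiability at positive times, hence
  continuity.\<close>

lemma continuous_on_integral_law:
  assumes "test_function \<phi>" "0 < e" "\<And>x. x \<le> e \<Longrightarrow> \<phi> x = 0"
  shows "continuous_on {0<..} (\<lambda>t. \<integral>x. \<phi> x \<partial>\<mu> t)"
proof -
  note T = test_function_equation[OF assms(1,2)] 
  have "continuous_on {0<..} (\<lambda>t. LBINT x. u x t * \<phi> x)"
    using T(1) assms(3)
    by (auto simp: has_caputo_derivative_def intro!: continuous_at_imp_continuous_on
        differentiable_imp_continuous_within)
  then have "continuous_on {0<..} (\<lambda>t. 2 * (LBINT x. u x t * \<phi> x))"
    by (intro continuous_intros)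
  then show ?thesis
  proof (rule continuous_on_eq)
    fix t :: real assume "t \<in> {0<..}"
    then show "2 * (LBINT x. u x t * \<phi> x) = (\<integral>x. \<phi> x \<partial>\<mu> t)"
      using T(5)[of t] assms(3)
        integral_law[OF _ borel_measurable_continuous_onI[OF test_function_properties(1)[OF assms(1)]], of t]
      by simp
  qed
qed

text \<open>With zero initial data the diffusion equation is transformed into \<kappa>^2 \<nu> =
  \<nu>'' for \<kappa> = s^\<alpha>, and the exponential form of \<nu> relates the integrals of f'
  and f. The term f0 / s is f0 times the mass of \<nu>.\<close>

lemma laplace_law:
  assumes s: "0 < s" 
    and d: "\<And>x. 0 < x \<Longrightarrow> (f has_real_derivative f' x) (at x)"
    and cont: "continuous_on {0<..} f'"
    and B: "\<And>x. 0 < x \<Longrightarrow> \<bar>f x\<bar> \<le> C" "\<And>x. 0 < x \<Longrightarrow> \<bar>f' x\<bar> \<le> C"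
    and lim: "(f \<longlongrightarrow> f0) (at_right 0)"
  shows "laplace_integrable (\<lambda>t. \<integral>x. indicator {0<..} x * f x \<partial>\<mu> t) s"
    and "laplace (\<lambda>t. \<integral>x. indicator {0<..} x * f' x \<partial>\<mu> t) s =
      s powr \<alpha> * (laplace (\<lambda>t. \<integral>x. indicator {0<..} x * f x \<partial>\<mu> t) s - f0 / s)"
proof -
  obtain \<nu> :: "real measure" where fin: "finite_measure \<nu>" and sets: "sets \<nu> = sets borel"
    and L: "\<And>h C. h \<in> borel_measurable borel \<Longrightarrow> (\<And>x. \<bar>h x\<bar> \<le> C) \<Longrightarrow>
      laplace_integrable (\<lambda>t. LBINT x. w x t * h x) s \<and>
      laplace (\<lambda>t. LBINT x. w x t * h x) s = (\<integral>x. h x \<partial>\<nu>)"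
    using laplace_mixture[OF w_measurable w_nonneg nn_integral_w s] by blast
  have L': "laplace_integrable (\<lambda>t. \<integral>x. h x \<partial>\<mu> t) s"
    "laplace (\<lambda>t. \<integral>x. h x \<partial>\<mu> t) s = (\<integral>x. h x \<partial>\<nu>)"
    if h: "h \<in> borel_measurable borel" and C: "\<And>x. \<bar>h x\<bar> \<le> C" for h C
    using L[OF h C] laplace_cong[of "\<lambda>t. \<integral>x. h x \<partial>\<mu> t" "\<lambda>t. LBINT x. w x t * h x" s]
      laplace_integrable_cong[of "\<lambda>t. \<integral>x. h x \<partial>\<mu> t" "\<lambda>t. LBINT x. w x t * h x" s]
      integral_law[OF _ h] by auto
  have eq: "(s powr \<alpha>)\<^sup>2 * (\<integral>x. \<phi> x \<partial>\<nu>) = (\<integral>x. deriv (deriv \<phi>) x \<partial>\<nu>)"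
    if \<phi>: "test_function \<phi>" "0 < e" "\<And>x. x \<le> e \<Longrightarrow> \<phi> x = 0" for \<phi> e
  proof -
    define m where "m = (\<lambda>t. LBINT x. u x t * \<phi> x)"
    define g where "g = (\<lambda>t. 1 / 2 * (LBINT x. w x t * deriv (deriv \<phi>) x))"
    obtain C where "\<And>x. \<bar>\<phi> x\<bar> \<le> C" "\<And>x. \<bar>deriv (deriv \<phi>) x\<bar> \<le> C"
      using test_function_properties(3)[OF \<phi>(1)] by auto
    note LC = L[OF borel_measurable_continuous_onI[OF test_function_properties(1)[OF \<phi>(1)]] this(1)]
      L[OF borel_measurable_continuous_onI[OF test_function_properties(2)[OF \<phi>(1)]] this(2)]
    have gi: "laplace_integrable g s"
      unfolding g_def by (rule laplace_cmult(1)) (use LC(2) in simp)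
    have Lg: "laplace g s = 1 / 2 * (\<integral>x. deriv (deriv \<phi>) x \<partial>\<nu>)"
      unfolding g_def laplace_cmult(2) using LC(2) by simp
    have "laplace_integrable m s \<and> laplace m s = 0 / s + s powr (- (2 * \<alpha>)) * laplace g s"
      using test_function_equation[OF \<phi>] \<alpha> s gi unfolding m_def[symmetric]
      by (intro laplace_caputo) (auto simp: g_def)
    moreover note Lg
    moreover have "laplace m s = 1 / 2 * (\<integral>x. \<phi> x \<partial>\<nu>)"
    proof -
      have "laplace m s = laplace (\<lambda>t. 1 / 2 * (LBINT x. w x t * \<phi> x)) s"
        using test_function_equation(5)[OF \<phi>] by (intro laplace_cong) (auto simp: m_def)
      then show ?thesis using LC(1) by (simp only: laplace_cmult(2))
    qed
    moreover have "(s powr \<alpha>)\<^sup>2 * s powr (- (2 * \<alpha>)) = 1"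
      using s by (simp add: power2_eq_square flip: powr_add)
    ultimately show ?thesis
      by (simp add: mult.assoc[symmetric])
  qed
  have f_cont: "continuous_on {0<..} f"
    using d by (auto intro!: continuous_at_imp_continuous_on DERIV_isCont)
  note meas = half_line_measurable[OF refl f_cont] half_line_measurable[OF refl cont]
    half_line_measurable[OF refl continuous_on_const[of _ f0]]
  have C: "0 \<le> C" using B(1)[of 1] by simp
  have bnd: "\<bar>indicator {0<..} x * f x\<bar> \<le> C" "\<bar>indicator {0<..} x * f' x\<bar> \<le> C"
    "\<bar>indicator {0<..} x * f0\<bar> \<le> \<bar>f0\<bar>" for x
    using B C by (auto simp: indicator_def)
  show "laplace_integrable (\<lambda>t. \<integral>x. indicator {0<..} x * f x \<partial>\<mu> t) s"
    by (rule L'(1)[OF meas(1) bnd(1)])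
  \<comment> \<open>Each \<open>\<mu> t\<close> is a probability measure carried by the open half
    line, so the mass of \<nu> there is the Laplace transform of 1.\<close>
  have ind_f0: "(\<integral>x. indicator {0<..} x * f0 \<partial>\<nu>) = f0 / s"
  proof -
    have "(\<integral>x. indicator {0<..} x * f0 \<partial>\<mu> t) = f0" if t: "0 < t" for t
    proof -
      interpret prob_space "\<mu> t" using prob_law[OF t] .
      have "(\<integral>x. indicator {0<..} x * f0 \<partial>\<mu> t) = (\<integral>x. f0 \<partial>\<mu> t)"
      proof (rule integral_cong_AE)
        show "AE x in \<mu> t. indicator {0<..} x * f0 = f0"
          using AE_law_pos[OF t] by eventually_elim simp
      qed (use half_line_measurable[OF sets_law[OF t], of "\<lambda>_. f0"] in auto)
      then show ?thesis by (simp add: prob_space)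
    qed
    then have "laplace (\<lambda>t. \<integral>x. indicator {0<..} x * f0 \<partial>\<mu> t) s = laplace (\<lambda>_. f0) s"
      by (intro laplace_cong)
    then show ?thesis
      using L'(2)[OF meas(3) bnd(3)] laplace_const(2)[OF s] by simp
  qed
  have "(\<integral>x. indicator {0<..} x * f' x \<partial>\<nu>) =
      s powr \<alpha> * (\<integral>x. indicator {0<..} x * (f x - f0) \<partial>\<nu>)"
    by (rule half_line_exponential[OF fin sets _ eq d cont B lim]) (use s in simp)
  also have "(\<integral>x. indicator {0<..} x * (f x - f0) \<partial>\<nu>) =
      (\<integral>x. indicator {0<..} x * f x \<partial>\<nu>) - f0 / s"
    using half_line_integrable[OF fin sets f_cont B(1)]
      half_line_integrable[OF fin sets, of "\<lambda>_. f0" "\<bar>f0\<bar>"] ind_f0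
    by (simp add: right_diff_distrib)
  finally show "laplace (\<lambda>t. \<integral>x. indicator {0<..} x * f' x \<partial>\<mu> t) s =
      s powr \<alpha> * (laplace (\<lambda>t. \<integral>x. indicator {0<..} x * f x \<partial>\<mu> t) s - f0 / s)"
    by (simp add: L'(2)[OF meas(1) bnd(1)] L'(2)[OF meas(2) bnd(2)])
qed

end

section \<open>Subordination at an independent time\<close>

text \<open>The time \<open>T\<close> is approximated from the right by times with countably many values. Negative times never
  occur, but the values of \<open>N\<close> there are unconstrained.\<close>

lemma (in prob_space) subordinated_prob:
  fixes N :: "real \<Rightarrow> 'a \<Rightarrow> nat" and T :: "'a \<Rightarrow> real"
  assumes N [measurable]: "\<And>t. 0 \<le> t \<Longrightarrow> N t \<in> measurable M (count_space UNIV)"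
    and rc: "\<And>\<omega> t. \<omega> \<in> space M \<Longrightarrow> 0 \<le> t \<Longrightarrow>
      ((\<lambda>s. real (N s \<omega>)) \<longlongrightarrow> real (N t \<omega>)) (at_right t)"
    and T [measurable]: "T \<in> borel_measurable M" and T_nonneg: "\<And>\<omega>. \<omega> \<in> space M \<Longrightarrow> 0 \<le> T \<omega>"
    and indep: "\<And>t. 0 \<le> t \<Longrightarrow> indep_var borel T borel (\<lambda>\<omega>. real (N t \<omega>))"
  shows "(\<lambda>\<omega>. N (T \<omega>) \<omega>) \<in> measurable M (count_space UNIV)"
    and "(\<And>t. 0 \<le> t \<Longrightarrow> (state_prob M N (int n) \<longlongrightarrow> state_prob M N (int n) t) (at_right t)) \<Longrightarrow>
      prob {\<omega> \<in> space M. N (T \<omega>) \<omega> = n} = (\<integral>\<omega>. state_prob M N (int n) (T \<omega>) \<partial>M)"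
proof -
  define I where "I k \<omega> = nat \<lfloor>real (Suc k) * T \<omega>\<rfloor>" for k \<omega>
  \<comment> \<open>The right end point of the grid cell with index i; \<open>Suc i\<close> puts it
    strictly to the right of \<open>T\<close>, so that right limits apply.\<close>
  define d where "d k i = real (Suc i) / real (Suc k)" for k i :: nat
  define X where "X k \<omega> = N (d k (I k \<omega>)) \<omega>" for k \<omega>
  have d0: "0 \<le> d k i" for k i by (simp add: d_def)
  have I_meas [measurable]: "I k \<in> measurable M (count_space UNIV)" for k
    unfolding I_def by measurable
  have X_meas [measurable]: "X k \<in> measurable M (count_space UNIV)" for k
    unfolding X_def by (rule measurable_compose_countable[where f = "\<lambda>i \<omega>. N (d k i) \<omega>"])
      (use N d0 in auto)
  have d_lim: "filterlim (\<lambda>k. d k (I k \<omega>)) (at_right (T \<omega>)) sequentially" if \<omega>: "\<omega> \<in> space M" for \<omega>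
  proof -
    have *: "T \<omega> < d k (I k \<omega>)" "d k (I k \<omega>) \<le> T \<omega> + inverse (real (Suc k))" for k
    proof -
      have "0 \<le> real (Suc k) * T \<omega>" using T_nonneg[OF \<omega>] by simp
      then have "real (I k \<omega>) \<le> real (Suc k) * T \<omega>" "real (Suc k) * T \<omega> < real (I k \<omega>) + 1"
        unfolding I_def by linarith+
      then have "T \<omega> < d k (I k \<omega>)" "d k (I k \<omega>) \<le> (real (Suc k) * T \<omega> + 1) / real (Suc k)"
        by (auto simp: d_def less_divide_eq mult.commute intro!: divide_right_mono)
      then show "T \<omega> < d k (I k \<omega>)" "d k (I k \<omega>) \<le> T \<omega> + inverse (real (Suc k))"
        by (simp_all add: add_divide_distrib inverse_eq_divide)
    qed
    have "(\<lambda>k. d k (I k \<omega>)) \<longlonglongrightarrow> T \<omega>"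
      using * by (intro tendsto_sandwich[OF _ _ tendsto_const[of "T \<omega>"]
            LIMSEQ_inverse_real_of_nat_add[of "T \<omega>"]] always_eventually allI) (simp_all only: less_imp_le)
    then show ?thesis
      unfolding filterlim_at using *(1) by (simp add: less_imp_neq[symmetric])
  qed
  have X_lim: "(\<lambda>k. real (X k \<omega>)) \<longlonglongrightarrow> real (N (T \<omega>) \<omega>)" if \<omega>: "\<omega> \<in> space M" for \<omega>
    unfolding X_def by (rule filterlim_compose[OF rc[OF \<omega> T_nonneg[OF \<omega>]] d_lim[OF \<omega>]])
  have real_meas: "(\<lambda>\<omega>. real (N (T \<omega>) \<omega>)) \<in> borel_measurable M"
    by (rule borel_measurable_LIMSEQ_real[OF X_lim]) auto
  then have "(\<lambda>\<omega>. nat \<lfloor>real (N (T \<omega>) \<omega>)\<rfloor>) \<in> measurable M (count_space UNIV)"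
    by measurable
  then show meas [measurable]: "(\<lambda>\<omega>. N (T \<omega>) \<omega>) \<in> measurable M (count_space UNIV)"
    by simp
  define p where "p = state_prob M N (int n)"
  have p_eq: "p t = prob {\<omega> \<in> space M. N t \<omega> = n}" for t
    by (simp add: p_def state_prob_def)
  have p01: "0 \<le> p t" "p t \<le> 1" for t by (auto simp: p_eq)
  assume p_rc: "\<And>t. 0 \<le> t \<Longrightarrow> (state_prob M N (int n) \<longlongrightarrow> state_prob M N (int n) t) (at_right t)"
  have step: "prob {\<omega> \<in> space M. X k \<omega> = n} = (\<integral>\<omega>. p (d k (I k \<omega>)) \<partial>M)" for k
  proof -
    \<comment> \<open>On each cell the random time is replaced by the deterministic
      \<open>d k i\<close>, where independence applies.\<close>
    have prod: "prob {\<omega> \<in> space M. I k \<omega> = i \<and> N (d k i) \<omega> = n} = prob {\<omega> \<in> space M. I k \<omega> = i} * p (d k i)" for i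
    proof -
      let ?A = "{x::real. nat \<lfloor>real (Suc k) * x\<rfloor> = i}"
      have A: "?A \<in> sets borel" by measurable
      have "prob ((\<lambda>\<omega>. (T \<omega>, real (N (d k i) \<omega>))) -` (?A \<times> {real n}) \<inter> space M) =
          prob (T -` ?A \<inter> space M) * prob ((\<lambda>\<omega>. real (N (d k i) \<omega>)) -` {real n} \<inter> space M)"
        by (rule indep_varD[OF indep[OF d0] A]) simp
      moreover have "(\<lambda>\<omega>. (T \<omega>, real (N (d k i) \<omega>))) -` (?A \<times> {real n}) \<inter> space M
          = {\<omega> \<in> space M. I k \<omega> = i \<and> N (d k i) \<omega> = n}"
        "T -` ?A \<inter> space M = {\<omega> \<in> space M. I k \<omega> = i}"
        "(\<lambda>\<omega>. real (N (d k i) \<omega>)) -` {real n} \<inter> space M = {\<omega> \<in> space M. N (d k i) \<omega> = n}"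
        by (auto simp: I_def)
      ultimately show ?thesis by (simp add: p_eq)
    qed
    have N_meas [measurable]: "N (d k i) \<in> measurable M (count_space UNIV)" for i
      by (rule N[OF d0])
    have "emeasure M {\<omega> \<in> space M. X k \<omega> = n} = (\<Sum>i. emeasure M {\<omega> \<in> space M. I k \<omega> = i \<and> N (d k i) \<omega> = n})"
    proof -
      have "(\<Union>i. {\<omega> \<in> space M. I k \<omega> = i \<and> N (d k i) \<omega> = n}) = {\<omega> \<in> space M. X k \<omega> = n}"
        by (auto simp: X_def)
      then show ?thesis
        by (subst suminf_emeasure) (auto simp: disjoint_family_on_def)
    qed
    also have "\<dots> = (\<Sum>i. \<integral>\<^sup>+\<omega>. ennreal (p (d k i)) * indicator {\<omega> \<in> space M. I k \<omega> = i} \<omega> \<partial>M)"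
    proof (rule suminf_cong)
      fix i
      have "emeasure M {\<omega> \<in> space M. I k \<omega> = i \<and> N (d k i) \<omega> = n} =
          ennreal (p (d k i)) * emeasure M {\<omega> \<in> space M. I k \<omega> = i}"
        by (simp add: emeasure_eq_measure prod ennreal_mult p01 mult.commute)
      also have "\<dots> = (\<integral>\<^sup>+\<omega>. ennreal (p (d k i)) * indicator {\<omega> \<in> space M. I k \<omega> = i} \<omega> \<partial>M)"
        by (rule nn_integral_cmult_indicator[symmetric]) measurable
      finally show "emeasure M {\<omega> \<in> space M. I k \<omega> = i \<and> N (d k i) \<omega> = n} = \<dots>" .
    qed
    also have "\<dots> = (\<integral>\<^sup>+\<omega>. (\<Sum>i. ennreal (p (d k i)) * indicator {\<omega> \<in> space M. I k \<omega> = i} \<omega>) \<partial>M)"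
      by (rule nn_integral_suminf[symmetric]) measurable
    also have "\<dots> = (\<integral>\<^sup>+\<omega>. ennreal (p (d k (I k \<omega>))) \<partial>M)"
    proof (rule nn_integral_cong)
      fix \<omega> assume "\<omega> \<in> space M"
      then have "(\<lambda>i. ennreal (p (d k i)) * indicator {\<omega> \<in> space M. I k \<omega> = i} \<omega>) =
          (\<lambda>i. if i = I k \<omega> then ennreal (p (d k (I k \<omega>))) else 0)"
        by (auto simp: fun_eq_iff indicator_def)
      then show "(\<Sum>i. ennreal (p (d k i)) * indicator {\<omega> \<in> space M. I k \<omega> = i} \<omega>) = ennreal (p (d k (I k \<omega>)))"
        using sums_unique[OF sums_single[of "I k \<omega>" "\<lambda>_. ennreal (p (d k (I k \<omega>)))"]] by simp
    qed
    also have "\<dots> = ennreal (\<integral>\<omega>. p (d k (I k \<omega>)) \<partial>M)"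
      using p01 by (intro nn_integral_eq_integral integrable_const_bound[where B = 1]) auto
    finally show ?thesis
      using p01 by (simp add: emeasure_eq_measure)
  qed
  have p_lim: "(\<lambda>k. p (d k (I k \<omega>))) \<longlonglongrightarrow> p (T \<omega>)" if \<omega>: "\<omega> \<in> space M" for \<omega>
    using filterlim_compose[OF p_rc[OF T_nonneg[OF \<omega>]] d_lim[OF \<omega>]] by (simp add: p_def)
  have p_meas: "(\<lambda>\<omega>. p (d k (I k \<omega>))) \<in> borel_measurable M" for k
    by measurable
  have lim1: "(\<lambda>k. \<integral>\<omega>. p (d k (I k \<omega>)) \<partial>M) \<longlonglongrightarrow> (\<integral>\<omega>. p (T \<omega>) \<partial>M)"
    using p01 p_lim p_meas borel_measurable_LIMSEQ_real[OF p_lim p_meas]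
    by (intro integral_dominated_convergence[where w = "\<lambda>_. 1"]) auto
  have "(\<lambda>k. \<integral>\<omega>. indicator {\<omega> \<in> space M. X k \<omega> = n} \<omega> \<partial>M) \<longlonglongrightarrow>
      (\<integral>\<omega>. indicator {\<omega> \<in> space M. N (T \<omega>) \<omega> = n} \<omega> \<partial>M :: real)"
  proof (intro integral_dominated_convergence[where w = "\<lambda>_. 1"] AE_I2)
    \<comment> \<open>Natural numbers at distance less than 1 are equal, so convergence of the
      values makes the indicators eventually constant.\<close>
    fix \<omega> assume \<omega>: "\<omega> \<in> space M"
    have "\<forall>\<^sub>F k in sequentially. dist (real (X k \<omega>)) (real (N (T \<omega>) \<omega>)) < 1"
      using X_lim[OF \<omega>] by (rule tendstoD) simp
    then have "\<forall>\<^sub>F k in sequentially. indicator {\<omega> \<in> space M. X k \<omega> = n} \<omega> =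
        (indicator {\<omega> \<in> space M. N (T \<omega>) \<omega> = n} \<omega> :: real)"
      by eventually_elim (auto simp: dist_real_def indicator_def)
    then show "(\<lambda>k. indicator {\<omega> \<in> space M. X k \<omega> = n} \<omega>) \<longlonglongrightarrow>
        (indicator {\<omega> \<in> space M. N (T \<omega>) \<omega> = n} \<omega> :: real)"
      by (rule tendsto_eventually)
  qed (auto simp: indicator_def)
  then have lim2: "(\<lambda>k. prob {\<omega> \<in> space M. X k \<omega> = n}) \<longlonglongrightarrow> prob {\<omega> \<in> space M. N (T \<omega>) \<omega> = n}"
    by simp
  show "prob {\<omega> \<in> space M. N (T \<omega>) \<omega> = n} = (\<integral>\<omega>. state_prob M N (int n) (T \<omega>) \<partial>M)"
    using LIMSEQ_unique[OF lim2[unfolded step] lim1] by (simp add: p_def)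
qed

text \<open>With m <= n in place of m = n, the convolutions at n and at n - 1 become sums over the
  same indices; the additional term has \<open>l\<close> at a negative index and is 0.\<close>

lemma discrete_conv_eq_sum:
  fixes l q :: "int \<Rightarrow> real"
  assumes l: "\<And>j. j < 0 \<Longrightarrow> l j = 0" and q: "\<And>k. k < 0 \<Longrightarrow> q k = 0" and m: "m \<le> int n"
  shows "discrete_conv l q m = (\<Sum>k\<le>n. l (m - int k) * q (int k))"
proof -
  let ?S = "(\<lambda>k. m - int k) ` {..n}"
  have "discrete_conv l q m = infsum (\<lambda>j. l j * q (m - j)) ?S"
    unfolding discrete_conv_def
  proof (rule infsum_cong_neutral)
    fix j assume j: "j \<in> UNIV - ?S"
    have "j < 0 \<or> m - j < 0"
    proof (rule ccontr)
      assume "\<not> ?thesis"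
      then have "j = m - int (nat (m - j))" "nat (m - j) \<le> n" using m by auto
      with j show False by blast
    qed
    then show "l j * q (m - j) = 0" using l q by auto
  qed auto
  also have "\<dots> = (\<Sum>j\<in>?S. l j * q (m - j))"
    by (rule infsum_finite) simp
  also have "\<dots> = (\<Sum>k\<le>n. l (m - int k) * q (int k))"
    by (subst sum.reindex) (auto simp: inj_on_def)
  finally show ?thesis .
qed

section \<open>State probabilities and their triangular system\<close>

locale cfpp_system =
  fixes a :: real and l :: "int \<Rightarrow> real" and M :: "'a measure" and N :: "real \<Rightarrow> 'a \<Rightarrow> nat"
  assumes cfpp: "cfpp a l M N" and intensity: "intensity_parameters l"
begin

definition p :: "nat \<Rightarrow> real \<Rightarrow> real" where
  "p n = state_prob M N (int n)"

sublocale prob_space M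
  using cfpp by (simp add: cfpp_def)

lemma p_bound: "\<bar>p n t\<bar> \<le> 1"
  by (simp add: p_def state_prob_def)

lemma p_tendsto_0: "(p n \<longlongrightarrow> of_bool (n = 0)) (at_right 0)"
proof -
  have "(p n \<longlongrightarrow> p n 0) (at_right 0)" "p n 0 = of_bool (n = 0)"
    using cfpp by (auto simp: cfpp_def p_def)
  then show ?thesis by simp
qed

lemma p_has_caputo: "has_caputo_derivative a (p n)"
  using cfpp by (simp add: cfpp_def p_def)

text \<open>The coefficients depend on n - k alone. Subtracting 1 in the integers makes the one for
  k = n equal to - l 0, because \<open>l\<close> vanishes at -1.\<close>

lemma p_caputo:
  assumes t: "0 < t"
  shows "caputo_derivative a (p n) t = (\<Sum>k\<le>n. (l (int (n - k) - 1) - l (int (n - k))) * p k t)"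
proof -
  let ?q = "\<lambda>k. state_prob M N k t"
  have l: "l j = 0" if "j < 0" for j using intensity that by (simp add: intensity_parameters_def)
  have q: "?q k = 0" if "k < 0" for k
  proof -
    have "{\<omega> \<in> space M. int (N t \<omega>) = k} = {}" using that by auto
    then show ?thesis unfolding state_prob_def by (metis measure_empty)
  qed
  have "caputo_derivative a (p n) t = - discrete_conv l ?q (int n) + discrete_conv l ?q (int n - 1)"
    using cfpp t by (simp add: cfpp_def p_def)
  also have "\<dots> = (\<Sum>k\<le>n. (l (int n - 1 - int k) - l (int n - int k)) * p k t)"
    by (simp add: discrete_conv_eq_sum[OF l q, where n = n] p_def left_diff_distrib sum_subtractf)
  also have "\<dots> = (\<Sum>k\<le>n. (l (int (n - k) - 1) - l (int (n - k))) * p k t)"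
    by (intro sum.cong refl) (auto simp: of_nat_diff algebra_simps)
  finally show ?thesis .
qed

lemma p_differentiable: "0 < t \<Longrightarrow> p n differentiable at t"
  using p_has_caputo by (simp add: has_caputo_derivative_def)

lemma p_continuous: "continuous_on {0<..} (p n)"
  using p_differentiable
  by (auto intro!: continuous_at_imp_continuous_on differentiable_imp_continuous_within)

lemma p_laplace_integrable:
  assumes "0 < s"
  shows "laplace_integrable (p n) s"
proof (rule laplace_integrable_bounded[OF assms _ p_bound])
  show "set_borel_measurable lborel {0<..} (p n)"
    unfolding set_borel_measurable_def
    using borel_measurable_continuous_on_indicator[OF _ p_continuous] by simp
qed

text \<open>One formula for all orders in (0, 1], in which the order appears only in the power of s.
  It serves the fractional process and the process of order 1 alike.\<close>

lemma laplace_p: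
  assumes a: "0 < a" "a \<le> 1" and s: "0 < s"
  shows "laplace (p n) s = of_bool (n = 0) / s
    + s powr (- a) * (\<Sum>k\<le>n. (l (int (n - k) - 1) - l (int (n - k))) * laplace (p k) s)"
proof -
  define c where "c k = l (int (n - k) - 1) - l (int (n - k))" for k
  have g: "laplace_integrable (\<lambda>t. \<Sum>k\<le>n. c k * p k t) s"
    "laplace (\<lambda>t. \<Sum>k\<le>n. c k * p k t) s = (\<Sum>k\<le>n. c k * laplace (p k) s)"
    using laplace_sum[of "{..n}" "\<lambda>k t. c k * p k t" s] laplace_cmult(1)[OF p_laplace_integrable[OF s]]
    by (auto simp: laplace_cmult(2))
  have "laplace_integrable (p n) s \<and> laplace (p n) s = of_bool (n = 0) / s
      + s powr (- a) * laplace (\<lambda>t. \<Sum>k\<le>n. c k * p k t) s"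
  proof (rule laplace_caputo[OF a(1) _ s p_has_caputo p_tendsto_0 _ _ g(1)])
    show "caputo_derivative a (p n) t = (\<Sum>k\<le>n. c k * p k t)" if "0 < t" for t
      unfolding c_def by (rule p_caputo[OF that])
  qed (use a in auto)
  then show ?thesis
    unfolding g(2) unfolding c_def by (rule conjunct2)
qed

end

text \<open>The term for k = n can be moved to the left, where its factor 1 - r c 0 is
  nonzero.\<close>

lemma triangular_recursion_unique:
  fixes x y d :: "nat \<Rightarrow> real"
  assumes x: "\<And>n. x n = d n + r * (\<Sum>k\<le>n. c (n - k) * x k)"
    and y: "\<And>n. y n = d n + r * (\<Sum>k\<le>n. c (n - k) * y k)" and r: "r * c 0 \<noteq> 1"
  shows "x n = y n"
proof (induction n rule: less_induct)
  case (less n)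
  have split: "(\<Sum>k\<le>n. c (n - k) * z k) = (\<Sum>k<n. c (n - k) * z k) + c 0 * z n" for z :: "nat \<Rightarrow> real"
    by (simp flip: lessThan_Suc_atMost)
  have "(\<Sum>k<n. c (n - k) * x k) = (\<Sum>k<n. c (n - k) * y k)"
    using less by (intro sum.cong) auto
  then have "x n = d n + r * ((\<Sum>k<n. c (n - k) * y k) + c 0 * x n)"
    "y n = d n + r * ((\<Sum>k<n. c (n - k) * y k) + c 0 * y n)"
    using x[of n] y[of n] unfolding split by simp_all
  then have "(1 - r * c 0) * (x n - y n) = 0"
    by algebra
  with r show ?case by simp
qed

lemma (in cfpp_system) p_eq_if_laplace_recursion:
  assumes a: "0 < a" "a \<le> 1"
    and cont: "\<And>n. continuous_on {0<..} (q n)" and B: "\<And>n t. 0 < t \<Longrightarrow> \<bar>q n t\<bar> \<le> 1"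
    and rec: "\<And>n s. 0 < s \<Longrightarrow> laplace (q n) s = of_bool (n = 0) / s
      + s powr (- a) * (\<Sum>k\<le>n. (l (int (n - k) - 1) - l (int (n - k))) * laplace (q k) s)"
    and t: "0 < t"
  shows "p n t = q n t"
proof -
  define D where "D t = p n t + (- 1) * q n t" for t
  have "D t = 0"
  proof (rule laplace_unique[of D 2, OF _ _ _ t])
    show "continuous_on {0<..} D"
      unfolding D_def by (intro continuous_intros p_continuous cont)
    show "\<bar>D t\<bar> \<le> 2" if "0 < t" for t
      using p_bound[of n t] B[OF that, of n] by (simp add: D_def)
    show "laplace D s = 0" if s: "0 < s" for s
    proof -
      have "set_borel_measurable lborel {0<..} (q n)"
        unfolding set_borel_measurable_def
        using borel_measurable_continuous_on_indicator[OF _ cont] by simp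
      then have q: "laplace_integrable (q n) s"
        by (rule laplace_integrable_bounded[OF s _ B])
      \<comment> \<open>The diagonal coefficient is - l 0 s^(-a), which is negative and hence
        different from 1.\<close>
      have "0 < l 0" "l (-1) = 0" using intensity by (auto simp: intensity_parameters_def)
      then have "s powr (- a) * (l (int 0 - 1) - l (int 0)) < 0"
        using s by (simp add: mult_less_0_iff)
      then have "laplace (p n) s = laplace (q n) s"
        by (intro triangular_recursion_unique[of "\<lambda>n. laplace (p n) s" "\<lambda>n. of_bool (n = 0) / s" "s powr (- a)"
              "\<lambda>i. l (int i - 1) - l (int i)" "\<lambda>n. laplace (q n) s"] laplace_p a s rec) simp
      moreover have "laplace D s = laplace (p n) s + (- 1) * laplace (q n) s"
        unfolding D_def laplace_cmult(2)[symmetric]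
        by (rule laplace_add(2)[OF p_laplace_integrable[OF s] laplace_cmult(1)[OF q]])
      ultimately show ?thesis by simp
    qed
  qed
  then show ?thesis by (simp add: D_def)
qed

lemma state_prob_subordination:
  assumes \<alpha>: "0 < \<alpha>" "\<alpha> \<le> 1" and l: "intensity_parameters l"
    and N\<alpha>: "cfpp \<alpha> l M\<alpha> N\<alpha>" and N: "cfpp 1 l M N"
    and T: "folded_diffusion_process \<alpha> M T" and t: "0 < t"
  shows "state_prob M\<alpha> N\<alpha> (int n) t = (\<integral>\<omega>. state_prob M N (int n) (T t \<omega>) \<partial>M)"
proof -
  interpret A: cfpp_system \<alpha> l M\<alpha> N\<alpha> by unfold_locales fact+
  interpret P: cfpp_system 1 l M N by unfold_locales fact+
  define c where "c = (\<lambda>i. l (int i - 1) - l (int i))"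
  define \<mu> where "\<mu> t = distr M borel (T t)" for t
  have T_meas [measurable]: "T t \<in> borel_measurable M" if "0 < t" for t
    using T that by (simp add: folded_diffusion_process_def)
  have prob\<mu>: "prob_space (\<mu> t)" if "0 < t" for t
    unfolding \<mu>_def by (rule P.prob_space_distr) (rule T_meas[OF that])
  have sets\<mu>: "sets (\<mu> t) = sets borel" for t by (simp add: \<mu>_def)
  \<comment> \<open>The expectation of \<open>P.p n\<close> at the random time. The indicator is
    there because \<open>P.p n\<close> is controlled at positive times, and it is 1 almost
    surely.\<close>
  define q where "q n t = (\<integral>x. indicator {0<..} x * P.p n x \<partial>\<mu> t)" for n t
  \<comment> \<open>By the equations of order 1 these combinations are the first two derivatives of
    the state probabilities, so the regularity required of test functions is automatic.\<close>
  define p' where "p' n t = (\<Sum>k\<le>n. c (n - k) * P.p k t)" for n t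
  define p'' where "p'' n t = (\<Sum>k\<le>n. c (n - k) * p' k t)" for n t
  have d: "(P.p n has_real_derivative p' n t) (at t)" if "0 < t" for n t
    using P.p_differentiable[OF that, of n] P.p_caputo[OF that, of n]
    by (simp add: p'_def c_def caputo_derivative_def DERIV_deriv_iff_real_differentiable[symmetric])
  have d': "(p' n has_real_derivative p'' n t) (at t)" if "0 < t" for n t
  proof -
    have "((\<lambda>t. \<Sum>k\<le>n. c (n - k) * P.p k t) has_real_derivative (\<Sum>k\<le>n. c (n - k) * p' k t)) (at t)"
      by (intro DERIV_sum DERIV_cmult d that)
    then show ?thesis by (simp add: p'_def[abs_def] p''_def)
  qed
  have p'_cont: "continuous_on {0<..} (p' n)" for n
    unfolding p'_def by (intro continuous_intros P.p_continuous)
  have p''_cont: "continuous_on {0<..} (p'' n)" for n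
    unfolding p''_def by (intro continuous_intros p'_cont)
  \<comment> \<open>The summand 1 bounds \<open>P.p n\<close> and the sum bounds its derivative; one
    constant has to serve both.\<close>
  define C where "C n = 1 + (\<Sum>k\<le>n. \<bar>c (n - k)\<bar>)" for n
  have p_C: "\<bar>P.p n t\<bar> \<le> C n" for n t
    using P.p_bound[of n t] by (simp add: C_def sum_nonneg add_increasing2)
  have p'_C: "\<bar>p' n t\<bar> \<le> C n" for n t
  proof -
    have "\<bar>p' n t\<bar> \<le> (\<Sum>k\<le>n. \<bar>c (n - k)\<bar> * \<bar>P.p k t\<bar>)"
      unfolding p'_def by (rule order_trans[OF sum_abs]) (simp add: abs_mult)
    also have "\<dots> \<le> (\<Sum>k\<le>n. \<bar>c (n - k)\<bar> * 1)"
      by (intro sum_mono mult_left_mono P.p_bound) auto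
    finally show ?thesis by (simp add: C_def)
  qed
  have q_bound: "\<bar>q n t\<bar> \<le> 1" if "0 < t" for n t
  proof -
    interpret prob_space "\<mu> t" using prob\<mu>[OF that] .
    have "\<bar>q n t\<bar> \<le> (\<integral>x. \<bar>indicator {0<..} x * P.p n x\<bar> \<partial>\<mu> t)"
      unfolding q_def by (rule integral_abs_bound)
    also have "\<dots> \<le> (\<integral>x. 1 \<partial>\<mu> t)"
      using P.p_bound half_line_integrable[OF finite_measure_axioms sets\<mu> P.p_continuous P.p_bound]
      by (intro integral_mono) (auto simp: indicator_def)
    finally show ?thesis by (simp add: prob_space)
  qed
  have core: "(\<forall>t>0. AE x in \<mu> t. 0 < x) \<and> (\<forall>t>0. A.p n t = q n t)"
  proof (cases "\<alpha> = 1")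
    case True
    have law: "\<mu> t = return borel t" if "0 < t" for t
      using T that True by (simp add: folded_diffusion_process_def \<mu>_def)
    have q_eq: "q n t = P.p n t" if "0 < t" for n t
    proof -
      have "(\<lambda>x. indicator {0<..} x * P.p n x) \<in> borel_measurable borel"
        by (rule half_line_measurable[OF refl P.p_continuous])
      then show ?thesis
        using that by (simp add: q_def law integral_return)
    qed
    \<comment> \<open>For \<alpha> = 1 the state probabilities of the convoluted Poisson process
      satisfy the same recursion.\<close>
    have "A.p n t = P.p n t" if "0 < t" for t
      by (rule A.p_eq_if_laplace_recursion[OF \<alpha> P.p_continuous P.p_bound _ that])
        (use P.laplace_p True in auto)
    moreover have "AE x in \<mu> t. 0 < x" if "0 < t" for t
      unfolding law[OF that] using that by (subst AE_return) auto
    ultimately show ?thesis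
      by (simp add: q_eq)
  next
    case False
    then have "\<exists>u. frac_diffusion_solution (2 * \<alpha>) u \<and>
        (\<forall>t>0. (AE x in lborel. 0 < x \<longrightarrow> 0 \<le> u x t) \<and>
           \<mu> t = density lborel (\<lambda>x. ennreal (indicator {0<..} x * (2 * u x t))))"
      using T unfolding folded_diffusion_process_def \<mu>_def by (simp only: if_False)
    then obtain u where u: "frac_diffusion_solution (2 * \<alpha>) u"
      "\<forall>t>0. (AE x in lborel. 0 < x \<longrightarrow> 0 \<le> u x t) \<and>
           \<mu> t = density lborel (\<lambda>x. ennreal (indicator {0<..} x * (2 * u x t)))"
      by (elim exE conjE)
    interpret folded_diffusion \<alpha> u \<mu>
    proof (rule folded_diffusion.intro)
      show "0 < \<alpha>" "\<alpha> < 1" using \<alpha> False by auto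
      show "AE x in lborel. 0 < x \<longrightarrow> 0 \<le> u x t"
        "\<mu> t = density lborel (\<lambda>x. ennreal (indicator {0<..} x * (2 * u x t)))" if "0 < t" for t
        using u(2) that by auto
    qed (fact u(1) prob\<mu>)+
    have q_cont: "continuous_on {0<..} (q n)" for n
      unfolding q_def
      by (rule half_line_vague_imp_continuous[OF prob\<mu> sets\<mu> AE_law_pos continuous_on_integral_law d d' p''_cont P.p_bound])
    have q_int: "laplace_integrable (q n) s" if s: "0 < s" for n s
      unfolding q_def by (rule laplace_law(1)[OF s d p'_cont p_C p'_C P.p_tendsto_0])
    have q_rec: "laplace (\<lambda>t. \<integral>x. indicator {0<..} x * p' n x \<partial>\<mu> t) s =
        s powr \<alpha> * (laplace (q n) s - of_bool (n = 0) / s)" if s: "0 < s" for n s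
      unfolding q_def by (rule laplace_law(2)[OF s d p'_cont p_C p'_C P.p_tendsto_0])
    have rec: "laplace (q n) s = of_bool (n = 0) / s
        + s powr (- \<alpha>) * (\<Sum>k\<le>n. c (n - k) * laplace (q k) s)" if s: "0 < s" for n s
    proof -
      \<comment> \<open>The derivative of \<open>P.p n\<close> is a combination of state
        probabilities up to \<open>n\<close>; this turns the relation between the transforms for p'
        and p into the recursion.\<close>
      have "(\<integral>x. indicator {0<..} x * p' n x \<partial>\<mu> t) = (\<Sum>k\<le>n. c (n - k) * q k t)" if "0 < t" for t
      proof -
        interpret prob_space "\<mu> t" using prob\<mu>[OF that] .
        note int = half_line_integrable[OF finite_measure_axioms sets\<mu> P.p_continuous P.p_bound]
        have "(\<integral>x. indicator {0<..} x * p' n x \<partial>\<mu> t) =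
            (\<integral>x. (\<Sum>k\<le>n. c (n - k) * (indicator {0<..} x * P.p k x)) \<partial>\<mu> t)"
          by (simp add: p'_def sum_distrib_left mult.left_commute)
        then show ?thesis
          using int by (simp add: q_def Bochner_Integration.integral_sum)
      qed
      then have "laplace (\<lambda>t. \<integral>x. indicator {0<..} x * p' n x \<partial>\<mu> t) s =
          laplace (\<lambda>t. \<Sum>k\<le>n. c (n - k) * q k t) s"
        by (rule laplace_cong)
      also have "\<dots> = (\<Sum>k\<le>n. c (n - k) * laplace (q k) s)"
        using laplace_sum(2)[of "{..n}" "\<lambda>k t. c (n - k) * q k t" s] laplace_cmult(1)[OF q_int[OF s]]
        by (simp add: laplace_cmult(2))
      finally have "s powr (- \<alpha>) * (\<Sum>k\<le>n. c (n - k) * laplace (q k) s) =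
          (s powr (- \<alpha>) * s powr \<alpha>) * (laplace (q n) s - of_bool (n = 0) / s)"
        unfolding q_rec[OF s] by simp
      also have "s powr (- \<alpha>) * s powr \<alpha> = 1"
        using s by (simp flip: powr_add)
      finally show ?thesis by simp
    qed
    have "A.p n t = q n t" if "0 < t" for t
      by (rule A.p_eq_if_laplace_recursion[OF assms(1,2) q_cont q_bound rec[unfolded c_def] that])
    then show ?thesis using AE_law_pos by auto
  qed
  have ind_meas: "(\<lambda>x. indicator {0<..} x * P.p n x) \<in> borel_measurable borel"
    by (rule half_line_measurable[OF refl P.p_continuous])
  have "state_prob M\<alpha> N\<alpha> (int n) t = q n t"
    using core t by (simp add: A.p_def)
  also have "\<dots> = (\<integral>\<omega>. indicator {0<..} (T t \<omega>) * P.p n (T t \<omega>) \<partial>M)"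
    unfolding q_def \<mu>_def using ind_meas T_meas[OF t] by (subst integral_distr) auto
  also have "\<dots> = (\<integral>\<omega>. P.p n (T t \<omega>) \<partial>M)"
  proof (rule integral_cong_AE)
    have T0: "0 \<le> T t \<omega>" if "\<omega> \<in> space M" for \<omega>
      using T t that by (simp add: folded_diffusion_process_def)
    show meas: "(\<lambda>\<omega>. indicator {0<..} (T t \<omega>) * P.p n (T t \<omega>)) \<in> borel_measurable M"
      using measurable_compose[OF T_meas[OF t] ind_meas] .
    \<comment> \<open>Measurability of \<open>P.p n\<close> at negative times is unknown. On
      \<open>space M\<close> the time is nonnegative, so adding the value at 0 represents the
      function exactly.\<close>
    have "(\<lambda>\<omega>. indicator {0<..} (T t \<omega>) * P.p n (T t \<omega>) + indicator {0} (T t \<omega>) * P.p n 0) \<in> borel_measurable M"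
      by (rule borel_measurable_add[OF meas borel_measurable_times[OF
              measurable_compose[OF T_meas[OF t] borel_measurable_indicator] borel_measurable_const]]) simp
    then show "(\<lambda>\<omega>. P.p n (T t \<omega>)) \<in> borel_measurable M"
      using T0 by (subst measurable_cong[where g = "\<lambda>\<omega>. indicator {0<..} (T t \<omega>) * P.p n (T t \<omega>)
          + indicator {0} (T t \<omega>) * P.p n 0"]) (auto simp: indicator_def le_less)
    have "AE x in distr M borel (T t). 0 < x"
      using core t unfolding \<mu>_def by blast
    from AE_distrD[OF T_meas[OF t] this]
    show "AE \<omega> in M. indicator {0<..} (T t \<omega>) * P.p n (T t \<omega>) = P.p n (T t \<omega>)"
      by eventually_elim simp
  qed
  finally show ?thesis by (simp add: P.p_def)
qed

section \<open>Equality of the laws at a fixed time\<close>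

theorem theorem4p2:
  fixes \<alpha> :: real and l :: "int \<Rightarrow> real"
    and M\<alpha> :: "'a measure" and N\<alpha> :: "real \<Rightarrow> 'a \<Rightarrow> nat"
    and M :: "'b measure" and N :: "real \<Rightarrow> 'b \<Rightarrow> nat" and T :: "real \<Rightarrow> 'b \<Rightarrow> real"
  assumes "0 < \<alpha>" and "\<alpha> \<le> 1"
    and "intensity_parameters l"
    and "cfpp \<alpha> l M\<alpha> N\<alpha>"
    and "cpp l M N"
    and "folded_diffusion_process \<alpha> M T"
    and "prob_space.indep_var M
           (\<Pi>\<^sub>M t\<in>{0<..}. borel) (\<lambda>\<omega>. \<lambda>t\<in>{0<..}. T t \<omega>)
           (\<Pi>\<^sub>M t\<in>{0..}. borel) (\<lambda>\<omega>. \<lambda>t\<in>{0..}. real (N t \<omega>))"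
  shows "\<forall>t>0. eq_in_distribution M\<alpha> (N\<alpha> t) M (\<lambda>\<omega>. N (T t \<omega>) \<omega>) (count_space UNIV)"
proof (intro allI impI)
  fix t :: real assume t: "0 < t"
  have cfpp1: "cfpp 1 l M N" and levy: "levy_process M (\<lambda>t \<omega>. real (N t \<omega>))"
    using assms(5) by (auto simp: cpp_def)
  interpret A: cfpp_system \<alpha> l M\<alpha> N\<alpha> by unfold_locales fact+
  interpret P: cfpp_system 1 l M N by unfold_locales fact+
  have N_meas: "N s \<in> measurable M (count_space UNIV)" if "0 \<le> s" for s
    using cfpp1 that by (simp add: cfpp_def)
  have N\<alpha>_meas: "N\<alpha> t \<in> measurable M\<alpha> (count_space UNIV)"
    using assms(4) t by (simp add: cfpp_def)
  have T_meas: "T t \<in> borel_measurable M" and T_nonneg: "\<And>\<omega>. \<omega> \<in> space M \<Longrightarrow> 0 \<le> T t \<omega>"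
    using assms(6) t by (auto simp: folded_diffusion_process_def)
  have rc: "((\<lambda>s. real (N s \<omega>)) \<longlongrightarrow> real (N r \<omega>)) (at_right r)" if "\<omega> \<in> space M" "0 \<le> r" for \<omega> r
    using levy that by (simp add: levy_process_def)
  \<comment> \<open>Projection of the two independent paths to single coordinates.\<close>
  have indep: "P.indep_var borel (T t) borel (\<lambda>\<omega>. real (N s \<omega>))" if s: "0 \<le> s" for s
  proof -
    have "P.indep_var borel ((\<lambda>f. f t) \<circ> (\<lambda>\<omega>. \<lambda>t\<in>{0<..}. T t \<omega>))
        borel ((\<lambda>f. f s) \<circ> (\<lambda>\<omega>. \<lambda>t\<in>{0..}. real (N t \<omega>)))"
      using t s by (intro P.indep_var_compose[OF assms(7)] measurable_component_singleton) auto
    then show ?thesis using t s by (simp add: comp_def)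
  qed
  have comp_meas: "(\<lambda>\<omega>. N (T t \<omega>) \<omega>) \<in> measurable M (count_space UNIV)"
    by (rule P.subordinated_prob(1)[OF N_meas rc T_meas T_nonneg indep])
  \<comment> \<open>Right continuity at 0 is the initial condition; at later times it comes from
    differentiability.\<close>
  have rc_p: "(state_prob M N (int n) \<longlongrightarrow> state_prob M N (int n) r) (at_right r)" if "0 \<le> r" for n r
  proof (cases "r = 0")
    case True
    then show ?thesis using cfpp1 by (simp add: cfpp_def)
  next
    case False
    then have "isCont (state_prob M N (int n)) r"
      using P.p_continuous[of n] that by (simp add: P.p_def[abs_def] continuous_on_eq_continuous_at)
    then show ?thesis
      unfolding isCont_def by (rule tendsto_within_subset) simp
  qed
  have prob_eq: "measure M\<alpha> {\<omega> \<in> space M\<alpha>. N\<alpha> t \<omega> = n} = measure M {\<omega> \<in> space M. N (T t \<omega>) \<omega> = n}" for n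
    using P.subordinated_prob(2)[OF N_meas rc T_meas T_nonneg indep rc_p, of n] state_prob_subordination[OF assms(1-4) cfpp1 assms(6) t, of n]
    by (simp add: state_prob_def)
  have "distr M\<alpha> (count_space UNIV) (N\<alpha> t) = distr M (count_space UNIV) (\<lambda>\<omega>. N (T t \<omega>) \<omega>)"
  proof (rule measure_eqI_countable)
    fix n :: nat
    have "N\<alpha> t -` {n} \<inter> space M\<alpha> = {\<omega> \<in> space M\<alpha>. N\<alpha> t \<omega> = n}"
      "(\<lambda>\<omega>. N (T t \<omega>) \<omega>) -` {n} \<inter> space M = {\<omega> \<in> space M. N (T t \<omega>) \<omega> = n}"
      by auto
    then show "emeasure (distr M\<alpha> (count_space UNIV) (N\<alpha> t)) {n} =
        emeasure (distr M (count_space UNIV) (\<lambda>\<omega>. N (T t \<omega>) \<omega>)) {n}"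
      using N\<alpha>_meas comp_meas prob_eq[of n]
      by (simp add: emeasure_distr A.emeasure_eq_measure P.emeasure_eq_measure)
  qed auto
  with N\<alpha>_meas comp_meas show "eq_in_distribution M\<alpha> (N\<alpha> t) M (\<lambda>\<omega>. N (T t \<omega>) \<omega>) (count_space UNIV)"
    by (simp add: eq_in_distribution_def)
qed

end
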